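(* Let $n_1,n_2$ be positive integers, $n=n_1n_2$, $1\le m\le n$, and let $A,B\in\mathbb{R}^{n\times n}$ be the matrices of the energy minimization problem for $m$ particles on the $n_1\times n_2$ toric grid (see context). Then the semidefinite bound $SDPQAP(A,B)$ (see context) equals the optimal value of the following semidefinite program in the variables $y^{b\to b}_{ij},y^{w\to w}_{ij},y^{b\leftrightarrow w}_{ij}$, indexed by all pairs $(i,j)$ with $i\in\{0,\dots,\lfloor n_1/2\rfloor\}$, $j\in\{0,\dots,\lfloor n_2/2\rfloor\}$, $i+j>0$ (all sums below run over these pairs): $$\begin{aligned} \inf\ & n\sum_{i+j>0}\frac{y^{b\to b}_{ij}}{i+j}\\ \text{s.t. } & \sum_{i+j>0}\bigl(y^{b\to b}_{ij}+y^{w\to w}_{ij}+y^{b\leftrightarrow w}_{ij}\bigr)=n-1,\\ & \text{for all } 0\le k\le\lfloor n_1/2\rfloor,\ 0\le l\le\lfloor n_2/2\rfloor:\\ &\quad \begin{pmatrix}\frac mn&0\\0&\frac{n-m}n\end{pmatrix}+\sum_{i+j>0}d^{kl}_{ij}\begin{pmatrix}y^{b\to b}_{ij}&\frac12y^{b\leftrightarrow w}_{ij}\\\frac12y^{b\leftrightarrow w}_{ij}&y^{w\to w}_{ij}\end{pmatrix}\succcurlyeq0,\\ &\quad \frac{m(m-1)}n-\sum_{i+j>0}d^{kl}_{ij}y^{b\to b}_{ij}\ge0,\\ &\quad \frac{(n-m)(n-m-1)}n-\sum_{i+j>0}d^{kl}_{ij}y^{w\to w}_{ij}\ge0,\\ &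 y^{b\to b}_{ij},\,y^{w\to w}_{ij},\,y^{b\leftrightarrow w}_{ij}\ge0\quad\text{for all }(i,j), \end{aligned}$$ where $d^{kl}_{ij}=\cos\left(\frac{2\pi ki}{n_1}\right)\cos\left(\frac{2\pi lj}{n_2}\right)$.
   Context: $[k]=\{1,\dots,k\}$. The grid points $[n_1]\times[n_2]$ are identified with $[n]$ via $(x,y)\mapsto n_2(x-1)+y$. The Lee distance is $d_{\mathrm{Lee}}((x_1,y_1),(x_2,y_2))=\min(|x_1-x_2|,n_1-|x_1-x_2|)+\min(|y_1-y_2|,n_2-|y_1-y_2|)$. The matrix $B=(b_{ij})$ has $b_{ij}=1/d_{\mathrm{Lee}}(i,j)$ for grid points $i\ne j$ and $b_{ii}=0$. The matrix $A=(a_{ij})$ has $a_{ij}=1$ if $i,j\le m$ and $a_{ij}=0$ otherwise. $SDPQAP(A,B)$ is the minimum of $\langle B\otimes A,Y\rangle$ over all $Y\in\mathbb{R}^{n^2\times n^2}$ that are symmetric positive semidefinite and entrywise nonnegative and satisfy $\langle I_n\otimes E_{jj},Y\rangle=1$ and $\langle E_{jj}\otimes I_n,Y\rangle=1$ for $j=1,\dots,n$, $\langle I_n\otimes(J_n-I_n)+(J_n-I_n)\otimes I_n,Y\rangle=0$, and $\langle J_{n^2},Y\rangle=n^2$. Here $I_k,J_k$ are the $k\times k$ identity and all-ones matrices, $E_{jj}$ is the $n\times n$ matrix with a single one at position $(j,j)$, $\langle X,Y\rangle=\mathrm{tr}(X^TY)$, $\otimes$ is the Kronecker product, and $\succcurlyeq0$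 means positive semidefinite. *)

theory Defs
  imports Jordan_Normal_Form.Matrix "HOL-Library.Extended_Real"
begin

text \<open>Matrix and grid indices start at 0 throughout: the grid point \<open>(x, y)\<close> with
  \<open>x < n1\<close> and \<open>y < n2\<close> has index \<open>n2 * x + y < n1 * n2\<close>.\<close>

definition psd_mat :: "real mat \<Rightarrow> bool" where
  "psd_mat M \<longleftrightarrow> square_mat M \<and> transpose_mat M = M \<and>
     (\<forall>v \<in> carrier_vec (dim_row M). 0 \<le> v \<bullet> (M *\<^sub>v v))"

definition mat_trace :: "real mat \<Rightarrow> real" where
  "mat_trace M = (\<Sum>i<dim_row M. M $$ (i, i))"

definition mat_inner :: "real mat \<Rightarrow> real mat \<Rightarrow> real" where
  "mat_inner X Y = mat_trace (transpose_mat X * Y)"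

definition kronecker :: "real mat \<Rightarrow> real mat \<Rightarrow> real mat" (infixl \<open>\<otimes>\<^sub>K\<close> 70) where
  "X \<otimes>\<^sub>K Y = mat (dim_row X * dim_row Y) (dim_col X * dim_col Y)
     (\<lambda>(i, j). X $$ (i div dim_row Y, j div dim_col Y) * Y $$ (i mod dim_row Y, j mod dim_col Y))"

definition J_mat :: "nat \<Rightarrow> real mat" where
  "J_mat k = mat k k (\<lambda>_. 1)"

definition E_mat :: "nat \<Rightarrow> nat \<Rightarrow> real mat" where
  "E_mat n j = mat n n (\<lambda>(a, b). if a = j \<and> b = j then 1 else 0)"

definition SDPQAP_feasible :: "nat \<Rightarrow> real mat set" where
  "SDPQAP_feasible n = {Y \<in> carrier_mat (n^2) (n^2).
     psd_mat Y \<and>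
     (\<forall>a<n^2. \<forall>b<n^2. 0 \<le> Y $$ (a, b)) \<and>
     (\<forall>j<n. mat_inner (1\<^sub>m n \<otimes>\<^sub>K E_mat n j) Y = 1) \<and>
     (\<forall>j<n. mat_inner (E_mat n j \<otimes>\<^sub>K 1\<^sub>m n) Y = 1) \<and>
     mat_inner (1\<^sub>m n \<otimes>\<^sub>K (J_mat n - 1\<^sub>m n) + (J_mat n - 1\<^sub>m n) \<otimes>\<^sub>K 1\<^sub>m n) Y = 0 \<and>
     mat_inner (J_mat (n^2)) Y = real (n^2)}"

text \<open>\<open>LEAST\<close> is the attained minimum; it is unspecified if no minimum exists.\<close>

definition SDPQAP :: "real mat \<Rightarrow> real mat \<Rightarrow> real" where
  "SDPQAP A B =
     (LEAST v. \<exists>Y \<in> SDPQAP_feasible (dim_row A). v = mat_inner (B \<otimes>\<^sub>K A) Y)"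

definition grid_point :: "nat \<Rightarrow> nat \<Rightarrow> nat \<times> nat" where
  "grid_point n2 p = (p div n2, p mod n2)"

fun lee_dist :: "nat \<Rightarrow> nat \<Rightarrow> nat \<times> nat \<Rightarrow> nat \<times> nat \<Rightarrow> int" where
  "lee_dist n1 n2 (x1, y1) (x2, y2) =
     min \<bar>int x1 - int x2\<bar> (int n1 - \<bar>int x1 - int x2\<bar>) +
     min \<bar>int y1 - int y2\<bar> (int n2 - \<bar>int y1 - int y2\<bar>)"

definition energy_A :: "nat \<Rightarrow> nat \<Rightarrow> real mat" where
  "energy_A n m = mat n n (\<lambda>(i, j). if i < m \<and> j < m then 1 else 0)"

definition energy_B :: "nat \<Rightarrow> nat \<Rightarrow> real mat" where
  "energy_B n1 n2 = mat (n1 * n2) (n1 * n2)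
     (\<lambda>(i, j). if i = j then 0
        else 1 / real_of_int (lee_dist n1 n2 (grid_point n2 i) (grid_point n2 j)))"

definition torus_pairs :: "nat \<Rightarrow> nat \<Rightarrow> (nat \<times> nat) set" where
  "torus_pairs n1 n2 = {(i, j). i \<le> n1 div 2 \<and> j \<le> n2 div 2 \<and> i + j > 0}"

definition torus_d :: "nat \<Rightarrow> nat \<Rightarrow> nat \<Rightarrow> nat \<Rightarrow> nat \<Rightarrow> nat \<Rightarrow> real" where
  "torus_d n1 n2 k l i j =
     cos (2 * pi * real k * real i / real n1) * cos (2 * pi * real l * real j / real n2)"

text \<open>The variables are functions on \<open>nat \<times> nat\<close>; only their values on
  \<^term>\<open>torus_pairs n1 n2\<close> enter the program. The names \<open>ybb\<close>, \<open>yww\<close>, \<open>ybw\<close> stand for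
  black-to-black, white-to-white and black-white (both directions).\<close>

definition torus_sdp_feasible ::
  "nat \<Rightarrow> nat \<Rightarrow> nat \<Rightarrow> ((nat \<Rightarrow> nat \<Rightarrow> real) \<times> (nat \<Rightarrow> nat \<Rightarrow> real) \<times> (nat \<Rightarrow> nat \<Rightarrow> real)) set" where
  "torus_sdp_feasible n1 n2 m = {(ybb, yww, ybw).
     let P = torus_pairs n1 n2; d = torus_d n1 n2; N = real (n1 * n2); M = real m in
     (\<Sum>(i, j)\<in>P. ybb i j + yww i j + ybw i j) = N - 1 \<and>
     (\<forall>k \<le> n1 div 2. \<forall>l \<le> n2 div 2.
        psd_mat
          (mat_of_rows_list 2 [[M / N, 0],
                               [0, (N - M) / N]] +
           mat_of_rows_list 2
             [[\<Sum>(i, j)\<in>P. d k l i j * ybb i j, \<Sum>(i, j)\<in>P. d k l i j * (1 / 2 * ybw i j)],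
              [\<Sum>(i, j)\<in>P. d k l i j * (1 / 2 * ybw i j), \<Sum>(i, j)\<in>P. d k l i j * yww i j]]) \<and>
        0 \<le> M * (M - 1) / N - (\<Sum>(i, j)\<in>P. d k l i j * ybb i j) \<and>
        0 \<le> (N - M) * (N - M - 1) / N - (\<Sum>(i, j)\<in>P. d k l i j * yww i j)) \<and>
     (\<forall>(i, j)\<in>P. 0 \<le> ybb i j \<and> 0 \<le> yww i j \<and> 0 \<le> ybw i j)}"

definition torus_sdp_objective :: "nat \<Rightarrow> nat \<Rightarrow> (nat \<Rightarrow> nat \<Rightarrow> real) \<Rightarrow> real" where
  "torus_sdp_objective n1 n2 ybb =
     real (n1 * n2) * (\<Sum>(i, j)\<in>torus_pairs n1 n2. ybb i j / real (i + j))"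

text \<open>Taken in the extended reals, so that an infeasible or unbounded program has an
  infinite value.\<close>

definition torus_sdp_value :: "nat \<Rightarrow> nat \<Rightarrow> nat \<Rightarrow> ereal" where
  "torus_sdp_value n1 n2 m =
     (INF (ybb, yww, ybw)\<in>torus_sdp_feasible n1 n2 m. ereal (torus_sdp_objective n1 n2 ybb))"

end

(*
Averaging a feasible matrix of the semidefinite relaxation over the symmetries of the two cycles
and over the permutations of the black and of the white particles leaves only the class sums
y_ij. The kernel cos(2 pi k (x - x') / n1) cos(2 pi l (y - y') / n2) depends only on the class of a
pair of grid points and is a sum of four products f(r) f(s). Testing positive semidefiniteness with
f(r) g(a) therefore gives the 2x2 conditions (g constant on each colour) and the two scalar
conditions (g = e_a - e_b with a, b of the same colour).

Conversely, discrete Fourier inversion on the torus writes the matrix with given class sums as a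
combination of these kernels, whose coefficient matrices have constant off-diagonal blocks on the
colours; the constraints of the small program are what makes these matrices positive semidefinite.

The small program has a closed feasible set, bounded in the relevant coordinates, so its infimum is
attained, and hence so is the minimum that defines SDPQAP.
*)

theory Submission
  imports Defs "HOL-Analysis.Function_Topology" "HOL-Analysis.Convex"
begin

section \<open>Fourier inversion on a cycle\<close>

text \<open>The right-hand sides of the scalar constraints are eigenvalue conditions. On a colour
  with M >= 2 particles the coefficient matrix at one frequency has, up to scaling, diagonal 1/n and
  equal off-diagonal entries p / (M (M - 1)). On zero-sum vectors it acts as 1/n - p / (M (M - 1)),
  which is nonnegative exactly when p <= M (M - 1) / n; vectors constant on the colours see the 2x2
  matrix. Three mismatches shape the details. Distance classes differ in size (on a cycle, distances
  0 and n/2 occur half as often), so \<open>circ_proj\<close> is normalised by its total and class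
  sizes never appear. Fourier inversion needs all frequencies k < n1, l < n2, while the program
  lists only half of each range; cosines at integer points do not change under k -> n1 - k. A colour
  with at most one particle has no pairs, so its formula divides by zero; the zero frequency then
  forces the corresponding variables to be 0.\<close>

text \<open>With \<open>z = cis (2 * pi * t / n)\<close> this is the real part of a geometric sum
  with \<open>z ^ n = 1\<close>, and \<open>z = 1\<close> exactly when \<open>n\<close> divides
  \<open>t\<close>.\<close>

lemma sum_cos_int_multiples:
  fixes t :: int
  assumes "n > 0"
  shows "(\<Sum>k<n. cos (2 * pi * real k * of_int t / real n)) = (if int n dvd t then real n else 0)"
proof -
  define z where "z = cis (2 * pi * of_int t / real n)"
  have pow: "z ^ k = cis (2 * pi * real k * of_int t / real n)" for k
    unfolding z_def DeMoivre by (simp add: algebra_simps)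
  have Re: "(\<Sum>k<n. cos (2 * pi * real k * of_int t / real n)) = Re (\<Sum>k<n. z ^ k)"
    by (simp add: pow)
  show ?thesis
  proof (cases "int n dvd t")
    case True
    then obtain q where q: "t = int n * q" by auto
    have "2 * pi * of_int t / real n = 2 * pi * of_int q"
      using assms by (simp add: q)
    then have "z = 1"
      by (simp only: z_def complex_eq_iff cis.sel cos_int_2pin sin_int_2pin) simp
    then show ?thesis
      using True Re by simp
  next
    case False
    have "z \<noteq> 1"
    proof
      assume "z = 1"
      then have "cos (2 * pi * of_int t / real n) = 1"
        by (metis cis.sel(1) one_complex.sel(1) z_def)
      then obtain q :: int where "2 * pi * of_int t / real n = of_int q * 2 * pi"
        unfolding cos_one_2pi_int by blast
      then have "of_int t = of_int q * real n"
        using assms by (simp add: field_simps)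
      then have "t = q * int n"
        by (metis of_int_eq_iff of_int_mult of_int_of_nat_eq)
      with False show False by simp
    qed
    moreover have "z ^ n = 1"
    proof -
      have "2 * pi * real n * of_int t / real n = 2 * pi * of_int t"
        using assms by simp
      then show ?thesis
        unfolding pow by (simp only: complex_eq_iff cis.sel cos_int_2pin sin_int_2pin) simp
    qed
    ultimately show ?thesis
      using False Re by (simp add: geometric_sum)
  qed
qed

text \<open>One coordinate of the Lee distance, as a \<open>nat\<close> so that pairs of such
  distances can index the variables of the program.\<close>

definition circ :: "nat \<Rightarrow> nat \<Rightarrow> nat \<Rightarrow> nat" where
  "circ n x x' = nat (min \<bar>int x - int x'\<bar> (int n - \<bar>int x - int x'\<bar>))"

lemma circ_le: "circ n x x' \<le> n div 2"
  unfolding circ_def by linarith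

lemma circ_eq_0_iff: "x < n \<Longrightarrow> x' < n \<Longrightarrow> circ n x x' = 0 \<longleftrightarrow> x = x'"
  unfolding circ_def by linarith

lemma int_circ: "x < n \<Longrightarrow> x' < n \<Longrightarrow> int (circ n x x') = min \<bar>int x - int x'\<bar> (int n - \<bar>int x - int x'\<bar>)"
  unfolding circ_def by linarith

text \<open>Up to sign and a multiple of \<open>n\<close>, the cycle distance is
  \<open>x - x'\<close>. The cosine is even, and a shift by \<open>n\<close> changes the angle by a
  multiple of \<open>2 * pi\<close>.\<close>

lemma cos_circ:
  assumes "x < n" "x' < n"
  shows "cos (2 * pi * real k * real (circ n x x') / real n) = cos (2 * pi * real k * (real x - real x') / real n)"
proof -
  define D where "D = real x - real x'"
  define c where "c = real (circ n x x')"
  have "int (circ n x x') \<in> {int x - int x', int x' - int x, int n - (int x - int x'), int n + (int x - int x')}"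
    unfolding int_circ[OF assms] by (auto simp: min_def abs_if)
  then have "real_of_int (int (circ n x x')) \<in> real_of_int ` {int x - int x', int x' - int x, int n - (int x - int x'), int n + (int x - int x')}"
    by (rule imageI)
  then consider "c = D" | "c = - D" | "c = real n - D" | "c = real n + D"
    by (auto simp: c_def D_def)
  then have "cos (2 * pi * real k * c / real n) = cos (2 * pi * real k * D / real n)"
  proof cases
    case 3
    have "2 * pi * real k * c / real n = 2 * pi * real k - 2 * pi * real k * D / real n"
      using assms by (simp add: 3 field_simps)
    then show ?thesis
      using cos_int_2pin[of "int k"] sin_int_2pin[of "int k"] by (simp add: cos_diff)
  next
    case 4
    have "2 * pi * real k * c / real n = 2 * pi * real k + 2 * pi * real k * D / real n"
      using assms by (simp add: 4 field_simps)
    then show ?thesis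
      using cos_int_2pin[of "int k"] sin_int_2pin[of "int k"] by (simp add: cos_add)
  qed simp_all
  then show ?thesis by (simp add: c_def D_def)
qed

text \<open>The entry \<open>(x, x')\<close> of \<open>(S^i + S^(-i)) / 2\<close>, with
  \<open>S\<close> the cyclic shift, given by its Fourier expansion.\<close>

definition circ_proj :: "nat \<Rightarrow> nat \<Rightarrow> nat \<Rightarrow> nat \<Rightarrow> real" where
  "circ_proj n i x x' = (\<Sum>k<n. cos (2 * pi * real k * real i / real n) *
     cos (2 * pi * real k * (real x - real x') / real n)) / real n"

text \<open>Product-to-sum turns each summand into the mean of two cosines, to which the
  root-of-unity sum applies.\<close>

lemma circ_proj_eq:
  assumes "n > 0"
  shows "circ_proj n i x x' = (of_bool (int n dvd int i - int x + int x') + of_bool (int n dvd int i + int x - int x')) / 2"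
proof -
  have "cos (2 * pi * real k * real i / real n) * cos (2 * pi * real k * (real x - real x') / real n)
    = (cos (2 * pi * real k * of_int (int i - int x + int x') / real n)
        + cos (2 * pi * real k * of_int (int i + int x - int x') / real n)) / 2" for k
    unfolding cos_times_cos
    by (simp add: algebra_simps diff_divide_distrib add_divide_distrib)
  then have "(\<Sum>k<n. cos (2 * pi * real k * real i / real n) * cos (2 * pi * real k * (real x - real x') / real n))
     = ((\<Sum>k<n. cos (2 * pi * real k * of_int (int i - int x + int x') / real n)) +
        (\<Sum>k<n. cos (2 * pi * real k * of_int (int i + int x - int x') / real n))) / 2"
    by (simp only: sum_divide_distrib[symmetric] sum.distrib)
  then show ?thesis
    unfolding circ_proj_def sum_cos_int_multiples[OF assms] using assms
    by (simp add: add_divide_distrib)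
qed

lemma circ_proj_nonneg: "n > 0 \<Longrightarrow> 0 \<le> circ_proj n i x x'"
  by (simp add: circ_proj_eq)

text \<open>The integers tested for divisibility in \<open>circ_proj_eq\<close> lie in this range
  when \<open>i \<le> n div 2\<close>.\<close>

lemma dvd_cases_small:
  fixes n t :: int
  assumes "n dvd t" "- n < t" "t < 2 * n"
  shows "t = 0 \<or> t = n"
proof -
  from assms(1) obtain q where q: "t = n * q" by auto
  have "n > 0" using assms by linarith
  have "n * (- 1) < n * q" "n * q < n * 2"
    using assms(2,3) unfolding q by linarith+
  then have "- 1 < q" "q < 2"
    using \<open>n > 0\<close> by (simp_all only: mult_less_cancel_left_pos)
  then have "q = 0 \<or> q = 1" by linarith
  then show ?thesis using q by auto
qed

text \<open>Divisibility leaves only the values 0 and \<open>n\<close>, so \<open>x - x'\<close> is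
  \<open>i\<close> or \<open>n - i\<close> up to sign; \<open>i \<le> n div 2\<close> makes
  \<open>i\<close> the smaller of the two, hence the cycle distance.\<close>

lemma circ_proj_eq_0:
  assumes "x < n" "x' < n" "i \<le> n div 2" "circ n x x' \<noteq> i"
  shows "circ_proj n i x x' = 0"
proof -
  have *: "int (circ n x x') = int i" if "int n dvd t" and
    t: "t = int i - int x + int x' \<or> t = int i + int x - int x'" for t
  proof -
    have "t = 0 \<or> t = int n"
      using that(1) by (rule dvd_cases_small) (use t assms in linarith)+
    then show ?thesis
      unfolding int_circ[OF assms(1,2)] using t assms(1-3) by linarith
  qed
  show ?thesis
    using assms *[of "int i - int x + int x'"] *[of "int i + int x - int x'"]
    by (auto simp: circ_proj_eq)
qed

lemma sum_of_bool_dvd_shift: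
  fixes t :: int
  assumes "n > 0"
  shows "(\<Sum>x<n. of_bool (int n dvd t + int x)) = (1::real)"
proof -
  have "{x\<in>{..<n}. int n dvd t + int x} = {nat ((- t) mod int n)}"
  proof (intro Set.set_eqI iffI)
    fix x assume "x \<in> {x\<in>{..<n}. int n dvd t + int x}"
    then have "x < n" "int n dvd int x - (- t)" by (auto simp: algebra_simps)
    then have "int x mod int n = (-t) mod int n" by (metis mod_eq_dvd_iff)
    then show "x \<in> {nat ((- t) mod int n)}" using \<open>x < n\<close> by auto
  next
    fix x assume "x \<in> {nat ((- t) mod int n)}"
    then have x: "int x = (- t) mod int n" using assms by simp
    have "int n dvd int x - (- t)" unfolding x by (metis mod_eq_dvd_iff mod_mod_trivial)
    moreover have "int x < int n" using assms by (simp add: x)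
    ultimately show "x \<in> {x\<in>{..<n}. int n dvd t + int x}" by (simp add: algebra_simps)
  qed
  then show ?thesis
    by (simp add: of_bool_def sum.If_cases Int_def)
qed

text \<open>Every row of a cyclic shift sums to 1. The total stays \<open>n\<close> at distances 0
  and \<open>n / 2\<close>, where there are fewer pairs but the two shifts coincide.\<close>

lemma sum_circ_proj:
  assumes "n > 0"
  shows "(\<Sum>x<n. \<Sum>x'<n. circ_proj n i x x') = real n"
proof -
  have 1: "(\<Sum>x<n. \<Sum>x'<n. of_bool (int n dvd int i - int x + int x')) = real n"
    using sum_of_bool_dvd_shift[OF assms, of "int i - int _"] by simp
  have "(\<Sum>x<n. \<Sum>x'<n. of_bool (int n dvd int i + int x - int x')) =
        (\<Sum>x'<n. \<Sum>x<n. (of_bool (int n dvd (int i - int x') + int x) :: real))"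
    by (subst sum.swap) (simp add: algebra_simps)
  then have 2: "(\<Sum>x<n. \<Sum>x'<n. of_bool (int n dvd int i + int x - int x')) = real n"
    using sum_of_bool_dvd_shift[OF assms] by simp
  show ?thesis
    using assms 1 2 by (simp add: circ_proj_eq sum_divide_distrib[symmetric] sum.distrib)
qed

lemma circ_proj_0:
  assumes "x < n" "x' < n"
  shows "circ_proj n 0 x x' = of_bool (x = x')"
proof (cases "x = x'")
  case False
  then show ?thesis
    using circ_proj_eq_0[OF assms, of 0] circ_eq_0_iff[OF assms] by simp
next
  case True
  then show ?thesis using assms by (simp add: circ_proj_eq)
qed

lemma circ_proj_commute: "circ_proj n i x x' = circ_proj n i x' x"
proof -
  have "cos (2 * pi * real k * (real x - real x') / real n) = cos (2 * pi * real k * (real x' - real x) / real n)" for k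
  proof -
    have "2 * pi * real k * (real x - real x') / real n = - (2 * pi * real k * (real x' - real x) / real n)"
      by (simp add: algebra_simps diff_divide_distrib)
    then show ?thesis by (simp only: cos_minus)
  qed
  then show ?thesis by (simp add: circ_proj_def)
qed

section \<open>Distance classes of the torus\<close>

lemma sum_lessThan_times:
  fixes f :: "nat \<Rightarrow> 'a :: comm_monoid_add"
  shows "(\<Sum>p<a * b. f p) = (\<Sum>i<a. \<Sum>j<b. f (i * b + j))"
proof -
  have "(\<Sum>p<a * b. f p) = (\<Sum>i<a. sum f {i * b..<i * b + b})"
    by (rule sum.nat_group[symmetric])
  also have "\<dots> = (\<Sum>i<a. \<Sum>j<b. f (i * b + j))"
  proof (rule sum.cong[OF refl])
    fix i
    show "sum f {i * b..<i * b + b} = (\<Sum>j<b. f (i * b + j))"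
      using sum.shift_bounds_nat_ivl[of f 0 "i * b" b] by (simp add: add.commute lessThan_atLeast0)
  qed
  finally show ?thesis .
qed

locale torus_grid =
  fixes n1 n2 :: nat
  assumes n1_pos: "n1 > 0" and n2_pos: "n2 > 0"
begin

abbreviation n :: nat where "n \<equiv> n1 * n2"
abbreviation P :: "(nat \<times> nat) set" where "P \<equiv> torus_pairs n1 n2"
abbreviation d :: "nat \<Rightarrow> nat \<Rightarrow> nat \<Rightarrow> nat \<Rightarrow> real" where "d \<equiv> torus_d n1 n2"

lemma n_pos: "n > 0"
  using n1_pos n2_pos by simp

lemma div_less: "r < n \<Longrightarrow> r div n2 < n1" and mod_less: "r mod n2 < n2"
  using n2_pos by (simp_all add: less_mult_imp_div_less)

lemma finite_P: "finite P"
  by (rule finite_subset[of _ "{..n1} \<times> {..n2}"]) (auto simp: torus_pairs_def intro: order_trans)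

definition cls :: "nat \<Rightarrow> nat \<Rightarrow> nat \<times> nat" where
  "cls r s = (circ n1 (r div n2) (s div n2), circ n2 (r mod n2) (s mod n2))"

lemma cls_eq_0_iff:
  assumes "r < n" "s < n"
  shows "cls r s = (0, 0) \<longleftrightarrow> r = s"
proof -
  have "cls r s = (0, 0) \<longleftrightarrow> r div n2 = s div n2 \<and> r mod n2 = s mod n2"
    using assms by (simp add: cls_def circ_eq_0_iff div_less mod_less)
  then show ?thesis by (metis div_mult_mod_eq)
qed

lemma cls_in_P: "r < n \<Longrightarrow> s < n \<Longrightarrow> r \<noteq> s \<Longrightarrow> cls r s \<in> P"
  using cls_eq_0_iff[of r s] by (auto simp: cls_def torus_pairs_def circ_le)

lemma zero_notin_P: "(0, 0) \<notin> P"
  by (simp add: torus_pairs_def)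

lemma lee_dist_grid_point:
  assumes "r < n" "s < n" "cls r s = (i, j)"
  shows "lee_dist n1 n2 (grid_point n2 r) (grid_point n2 s) = int (i + j)"
  using assms int_circ[OF div_less div_less, of r s] int_circ[OF mod_less mod_less, of r s]
  by (simp add: cls_def grid_point_def)

definition kern :: "nat \<Rightarrow> nat \<Rightarrow> nat \<Rightarrow> nat \<Rightarrow> real" where
  "kern k l r s = cos (2 * pi * real k * (real (r div n2) - real (s div n2)) / real n1) *
     cos (2 * pi * real l * (real (r mod n2) - real (s mod n2)) / real n2)"

lemma kern_eq_d:
  assumes "r < n" "s < n" "cls r s = (i, j)"
  shows "kern k l r s = d k l i j"
  using assms(3) cos_circ[OF div_less div_less, of r s k, OF assms(1,2)] cos_circ[OF mod_less mod_less, of l r s]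
  unfolding kern_def torus_d_def cls_def by simp

text \<open>The Booleans choose cosine or sine in each coordinate: real forms of the characters of
  the torus.\<close>

definition harm :: "nat \<Rightarrow> nat \<Rightarrow> bool \<Rightarrow> bool \<Rightarrow> nat \<Rightarrow> real" where
  "harm k l u v r = (if u then cos else sin) (2 * pi * real k * real (r div n2) / real n1) *
     (if v then cos else sin) (2 * pi * real l * real (r mod n2) / real n2)"

text \<open>The subtraction formula of the cosine, once in each coordinate.\<close>

lemma kern_harm: "kern k l r s = (\<Sum>u\<in>UNIV. \<Sum>v\<in>UNIV. harm k l u v r * harm k l u v s)"
  by (simp add: kern_def harm_def UNIV_bool right_diff_distrib diff_divide_distrib cos_diff algebra_simps)

definition proj :: "nat \<times> nat \<Rightarrow> nat \<Rightarrow> nat \<Rightarrow> real" where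
  "proj c r s = circ_proj n1 (fst c) (r div n2) (s div n2) * circ_proj n2 (snd c) (r mod n2) (s mod n2)"

text \<open>Fourier inversion, obtained by multiplying out the two cycle expansions. All frequencies
  occur, not just those with \<open>k \<le> n1 div 2\<close> and
  \<open>l \<le> n2 div 2\<close>.\<close>

lemma proj_kern:
  "proj (i, j) r s = (\<Sum>k<n1. \<Sum>l<n2. d k l i j * kern k l r s) / real n"
  by (simp add: proj_def circ_proj_def kern_def torus_d_def sum_product algebra_simps)

lemma proj_nonneg: "0 \<le> proj c r s"
  by (simp add: proj_def circ_proj_nonneg n1_pos n2_pos)

lemma proj_eq_0:
  assumes "r < n" "s < n" "c \<in> P" "cls r s \<noteq> c"
  shows "proj c r s = 0"
  using assms circ_proj_eq_0[OF div_less div_less, of r s "fst c"] circ_proj_eq_0[OF mod_less mod_less, of "snd c" r s]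
  by (cases c) (auto simp: proj_def cls_def torus_pairs_def)

lemma proj_0:
  assumes "r < n" "s < n"
  shows "proj (0, 0) r s = of_bool (r = s)"
proof -
  have "proj (0, 0) r s = of_bool (r div n2 = s div n2 \<and> r mod n2 = s mod n2)"
    using assms by (simp add: proj_def circ_proj_0 div_less mod_less)
  moreover have "r div n2 = s div n2 \<and> r mod n2 = s mod n2 \<longleftrightarrow> r = s"
    by (metis div_mult_mod_eq)
  ultimately show ?thesis by simp
qed

lemma sum_proj: "(\<Sum>r<n. \<Sum>s<n. proj c r s) = real n"
proof -
  have "(\<Sum>r<n. \<Sum>s<n. proj c r s) = (\<Sum>x<n1. \<Sum>y<n2. \<Sum>x'<n1. \<Sum>y'<n2.
      circ_proj n1 (fst c) x x' * circ_proj n2 (snd c) y y')"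
    by (simp add: sum_lessThan_times proj_def)
  also have "\<dots> = (\<Sum>x<n1. \<Sum>x'<n1. circ_proj n1 (fst c) x x') * (\<Sum>y<n2. \<Sum>y'<n2. circ_proj n2 (snd c) y y')"
    unfolding sum_product by (intro sum.cong refl sum.swap)
  finally show ?thesis by (simp add: sum_circ_proj n1_pos n2_pos)
qed

definition agg :: "(nat \<Rightarrow> nat \<Rightarrow> real) \<Rightarrow> nat \<times> nat \<Rightarrow> real" where
  "agg G c = (\<Sum>(r, s) | r < n \<and> s < n \<and> cls r s = c. G r s)"

text \<open>The class \<open>(0, 0)\<close> is exactly the diagonal. It is kept apart because it
  carries no variable; its contribution becomes the constants \<open>m / n\<close> and
  \<open>(n - m) / n\<close> of the program and the 1 subtracted in \<open>n - 1\<close>.\<close>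

lemma sum_cls:
  assumes "\<And>r s. r < n \<Longrightarrow> s < n \<Longrightarrow> H r s = F (cls r s) * G r s"
  shows "(\<Sum>r<n. \<Sum>s<n. H r s) = F (0, 0) * (\<Sum>r<n. G r r) + (\<Sum>c\<in>P. F c * agg G c)"
proof -
  let ?S = "{..<n} \<times> {..<n}"
  have "(\<Sum>r<n. \<Sum>s<n. H r s) = (\<Sum>p\<in>?S. F (cls (fst p) (snd p)) * G (fst p) (snd p))"
    by (simp add: sum.cartesian_product case_prod_unfold assms)
  also have "\<dots> = (\<Sum>c\<in>insert (0, 0) P. \<Sum>p | p \<in> ?S \<and> cls (fst p) (snd p) = c.
      F (cls (fst p) (snd p)) * G (fst p) (snd p))"
  proof (rule sum.group[symmetric])
    show "(\<lambda>p. cls (fst p) (snd p)) ` ?S \<subseteq> insert (0, 0) P"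
      using cls_in_P cls_eq_0_iff by fastforce
  qed (use finite_P in auto)
  also have "\<dots> = (\<Sum>c\<in>insert (0, 0) P. F c * agg G c)"
  proof (rule sum.cong[OF refl])
    fix c
    show "(\<Sum>p | p \<in> ?S \<and> cls (fst p) (snd p) = c. F (cls (fst p) (snd p)) * G (fst p) (snd p)) = F c * agg G c"
      unfolding agg_def sum_distrib_left case_prod_unfold by (rule sum.cong) auto
  qed
  also have "\<dots> = F (0, 0) * agg G (0, 0) + (\<Sum>c\<in>P. F c * agg G c)"
    by (simp add: finite_P zero_notin_P)
  also have "agg G (0, 0) = (\<Sum>(r, s)\<in>(\<lambda>r. (r, r)) ` {..<n}. G r s)"
    unfolding agg_def by (rule sum.cong) (auto simp: cls_eq_0_iff)
  also have "\<dots> = (\<Sum>r<n. G r r)"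
    by (subst sum.reindex) (auto simp: inj_on_def)
  finally show ?thesis .
qed

text \<open>An explicit Schur product argument: each of the four harmonics gives a test vector
  \<open>harm k l u v r * g a\<close>, and adding the four forms restores the kernel.\<close>

lemma kern_sum_nonneg:
  assumes "\<And>v. 0 \<le> (\<Sum>r<n. \<Sum>s<n. \<Sum>a<n. \<Sum>b<n. v r a * v s b * y r a s b)"
  shows "0 \<le> (\<Sum>r<n. \<Sum>s<n. kern k l r s * (\<Sum>a<n. \<Sum>b<n. g a * g b * y r a s b))"
proof -
  have "(\<Sum>r<n. \<Sum>s<n. kern k l r s * (\<Sum>a<n. \<Sum>b<n. g a * g b * y r a s b)) =
     (\<Sum>r<n. \<Sum>s<n. \<Sum>u\<in>UNIV. \<Sum>v\<in>UNIV. \<Sum>a<n. \<Sum>b<n. (harm k l u v r * g a) * (harm k l u v s * g b) * y r a s b)"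
    unfolding kern_harm sum_distrib_right unfolding sum_distrib_left
    by (intro sum.cong refl) (simp only: mult_ac)
  also have "\<dots> = (\<Sum>u\<in>UNIV. \<Sum>v\<in>UNIV. \<Sum>r<n. \<Sum>s<n. \<Sum>a<n. \<Sum>b<n. (harm k l u v r * g a) * (harm k l u v s * g b) * y r a s b)"
    by (simp only: UNIV_bool sum.insert finite.intros sum.empty insert_iff empty_iff simp_thms sum.distrib add_0_right)
  also have "0 \<le> \<dots>"
    by (intro sum_nonneg assms)
  finally show ?thesis .
qed

text \<open>Each frequency contributes a Kronecker product of two positive semidefinite matrices,
  and such products are positive semidefinite.\<close>

lemma kern_combination_psd:
  assumes W: "\<And>k l w. k < n1 \<Longrightarrow> l < n2 \<Longrightarrow> 0 \<le> (\<Sum>a<n. \<Sum>b<n. w a * w b * W k l a b)"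
  shows "0 \<le> (\<Sum>r<n. \<Sum>s<n. \<Sum>a<n. \<Sum>b<n. v r a * v s b * (\<Sum>k<n1. \<Sum>l<n2. kern k l r s * W k l a b))"
    (is "0 \<le> ?L")
proof -
  \<comment> \<open>Contracting the grid index of \<open>v\<close> with one harmonic leaves a vector
    on the particles; the form of the whole matrix is the sum of the forms of \<open>W k l\<close>
    at these vectors.\<close>
  define h where "h k l u t a = (\<Sum>r<n. harm k l u t r * v r a)" for k l u t a
  have "(\<Sum>a<n. \<Sum>b<n. h k l u t a * h k l u t b * W k l a b) =
     (\<Sum>r<n. \<Sum>s<n. \<Sum>a<n. \<Sum>b<n. v r a * v s b * (harm k l u t r * harm k l u t s * W k l a b))" for k l u t
  proof -
    have "(\<Sum>a<n. \<Sum>b<n. h k l u t a * h k l u t b * W k l a b) =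
      (\<Sum>a<n. \<Sum>b<n. \<Sum>r<n. \<Sum>s<n. v r a * v s b * (harm k l u t r * harm k l u t s * W k l a b))"
      unfolding h_def sum_product unfolding sum_distrib_right
      by (intro sum.cong refl) (simp only: mult_ac)
    also have "\<dots> = (\<Sum>a<n. \<Sum>r<n. \<Sum>b<n. \<Sum>s<n. v r a * v s b * (harm k l u t r * harm k l u t s * W k l a b))"
      by (intro sum.cong refl sum.swap)
    also have "\<dots> = (\<Sum>r<n. \<Sum>a<n. \<Sum>b<n. \<Sum>s<n. v r a * v s b * (harm k l u t r * harm k l u t s * W k l a b))"
      by (rule sum.swap)
    also have "\<dots> = (\<Sum>r<n. \<Sum>a<n. \<Sum>s<n. \<Sum>b<n. v r a * v s b * (harm k l u t r * harm k l u t s * W k l a b))"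
      by (intro sum.cong refl sum.swap)
    also have "\<dots> = (\<Sum>r<n. \<Sum>s<n. \<Sum>a<n. \<Sum>b<n. v r a * v s b * (harm k l u t r * harm k l u t s * W k l a b))"
      by (intro sum.cong refl sum.swap)
    finally show ?thesis .
  qed
  then have nn: "0 \<le> (\<Sum>r<n. \<Sum>s<n. \<Sum>a<n. \<Sum>b<n. v r a * v s b * (harm k l u t r * harm k l u t s * W k l a b))"
    if "k < n1" "l < n2" for k l u t
    using W[OF that, of "h k l u t"] by simp
  \<comment> \<open>Carries an innermost sum past four outer ones at once, by induction on its
    length.\<close>
  have pull: "(\<Sum>r<n. \<Sum>s<n. \<Sum>a<n. \<Sum>b<n. \<Sum>k<N. f k r s a b) = (\<Sum>k<N. \<Sum>r<n. \<Sum>s<n. \<Sum>a<n. \<Sum>b<n. f k r s a b)"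
    for N and f :: "nat \<Rightarrow> nat \<Rightarrow> nat \<Rightarrow> nat \<Rightarrow> nat \<Rightarrow> real"
    by (induction N) (simp_all add: sum.distrib)
  have "?L = (\<Sum>k<n1. \<Sum>l<n2. \<Sum>r<n. \<Sum>s<n. \<Sum>a<n. \<Sum>b<n. v r a * v s b * (kern k l r s * W k l a b))"
    by (simp only: sum_distrib_left pull)
  also have "\<dots> = (\<Sum>k<n1. \<Sum>l<n2. \<Sum>u\<in>UNIV. \<Sum>t\<in>UNIV. \<Sum>r<n. \<Sum>s<n. \<Sum>a<n. \<Sum>b<n. v r a * v s b * (harm k l u t r * harm k l u t s * W k l a b))"
    by (simp only: kern_harm UNIV_bool sum.insert finite.intros sum.empty insert_iff empty_iff simp_thms
        sum.distrib add_0_right distrib_left distrib_right)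
  also have "0 \<le> \<dots>"
    by (intro sum_nonneg nn) auto
  finally show ?thesis .
qed

end

section \<open>Block form of the relaxation\<close>

lemma quadratic_form_eq:
  fixes M :: "real mat"
  assumes "M \<in> carrier_mat N N" "v \<in> carrier_vec N"
  shows "v \<bullet> (M *\<^sub>v v) = (\<Sum>p<N. \<Sum>q<N. v $ p * v $ q * M $$ (p, q))"
  using assms by (simp add: scalar_prod_def lessThan_atLeast0 sum_distrib_left) (auto intro!: sum.cong simp: mult_ac)

text \<open>Test vectors become arbitrary functions without carrier conditions, which suits vectors
  indexed by pairs.\<close>

lemma psd_mat_iff:
  assumes "M \<in> carrier_mat N N"
  shows "psd_mat M \<longleftrightarrow> (\<forall>p<N. \<forall>q<N. M $$ (p, q) = M $$ (q, p)) \<and>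
    (\<forall>w :: nat \<Rightarrow> real. 0 \<le> (\<Sum>p<N. \<Sum>q<N. w p * w q * M $$ (p, q)))"
proof -
  have "transpose_mat M = M \<longleftrightarrow> (\<forall>p<N. \<forall>q<N. M $$ (p, q) = M $$ (q, p))"
    using assms by (auto simp: mat_eq_iff)
  moreover have "(\<forall>v \<in> carrier_vec N. 0 \<le> v \<bullet> (M *\<^sub>v v)) \<longleftrightarrow>
    (\<forall>w :: nat \<Rightarrow> real. 0 \<le> (\<Sum>p<N. \<Sum>q<N. w p * w q * M $$ (p, q)))"
  proof (intro iffI ballI allI)
    fix w :: "nat \<Rightarrow> real"
    assume "\<forall>v \<in> carrier_vec N. 0 \<le> v \<bullet> (M *\<^sub>v v)"
    then have "0 \<le> vec N w \<bullet> (M *\<^sub>v vec N w)" by simp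
    then show "0 \<le> (\<Sum>p<N. \<Sum>q<N. w p * w q * M $$ (p, q))"
      by (simp add: quadratic_form_eq[OF assms])
  qed (simp add: quadratic_form_eq[OF assms])
  ultimately show ?thesis
    using assms by (auto simp: psd_mat_def)
qed

lemma mat_inner_eq:
  assumes "X \<in> carrier_mat N N" "Y \<in> carrier_mat N N"
  shows "mat_inner X Y = (\<Sum>p<N. \<Sum>q<N. X $$ (p, q) * Y $$ (p, q))"
proof -
  have "mat_inner X Y = (\<Sum>q<N. \<Sum>p<N. X $$ (p, q) * Y $$ (p, q))"
    using assms by (simp add: mat_inner_def mat_trace_def scalar_prod_def lessThan_atLeast0)
  also have "\<dots> = (\<Sum>p<N. \<Sum>q<N. X $$ (p, q) * Y $$ (p, q))"
    by (rule sum.swap)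
  finally show ?thesis .
qed

definition block :: "nat \<Rightarrow> real mat \<Rightarrow> nat \<Rightarrow> nat \<Rightarrow> nat \<Rightarrow> nat \<Rightarrow> real" where
  "block n Y r a s b = Y $$ (r * n + a, s * n + b)"

lemma block_index_less: "r < n \<Longrightarrow> a < n \<Longrightarrow> r * n + a < n * (n :: nat)"
  using mult_le_mono1[of "Suc r" n n] by simp

lemma block_mat:
  assumes "r < n" "a < n" "s < n" "b < n"
  shows "block n (mat (n^2) (n^2) (\<lambda>(p, q). y (p div n) (p mod n) (q div n) (q mod n))) r a s b = y r a s b"
  using assms block_index_less[of r n a] block_index_less[of s n b] by (simp add: block_def power2_eq_square)

lemma sum_square_blocks:
  fixes f :: "nat \<Rightarrow> nat \<Rightarrow> real"
  shows "(\<Sum>p<n^2. \<Sum>q<n^2. f p q) = (\<Sum>r<n. \<Sum>s<n. \<Sum>a<n. \<Sum>b<n. f (r * n + a) (s * n + b))"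
  unfolding power2_eq_square sum_lessThan_times by (intro sum.cong refl sum.swap)

lemma inner_kronecker:
  assumes "X \<in> carrier_mat n n" "Z \<in> carrier_mat n n" "Y \<in> carrier_mat (n^2) (n^2)"
  shows "mat_inner (X \<otimes>\<^sub>K Z) Y = (\<Sum>r<n. \<Sum>s<n. \<Sum>a<n. \<Sum>b<n. X $$ (r, s) * Z $$ (a, b) * block n Y r a s b)"
proof -
  have XZ: "X \<otimes>\<^sub>K Z \<in> carrier_mat (n^2) (n^2)"
    using assms by (simp add: kronecker_def power2_eq_square)
  show ?thesis
    unfolding mat_inner_eq[OF XZ assms(3)] sum_square_blocks
    using assms block_index_less
    by (intro sum.cong refl) (simp add: kronecker_def block_def)
qed

text \<open>In \<open>y r a s b\<close> the indices \<open>r, s\<close> belong to the left Kronecker factor (grid points) and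
  \<open>a, b\<close> to the right one (particles).\<close>

definition qap_blocks :: "nat \<Rightarrow> (nat \<Rightarrow> nat \<Rightarrow> nat \<Rightarrow> nat \<Rightarrow> real) \<Rightarrow> bool" where
  "qap_blocks n y \<longleftrightarrow>
     (\<forall>r<n. \<forall>a<n. \<forall>s<n. \<forall>b<n. y r a s b = y s b r a) \<and>
     (\<forall>v. 0 \<le> (\<Sum>r<n. \<Sum>s<n. \<Sum>a<n. \<Sum>b<n. v r a * v s b * y r a s b)) \<and>
     (\<forall>r<n. \<forall>a<n. \<forall>s<n. \<forall>b<n. 0 \<le> y r a s b) \<and>
     (\<forall>a<n. (\<Sum>r<n. y r a r a) = 1) \<and>
     (\<forall>r<n. (\<Sum>a<n. y r a r a) = 1) \<and>
     (\<forall>r<n. \<forall>a<n. \<forall>b<n. a \<noteq> b \<longrightarrow> y r a r b = 0) \<and>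
     (\<forall>r<n. \<forall>a<n. \<forall>s<n. r \<noteq> s \<longrightarrow> y r a s a = 0) \<and>
     (\<Sum>r<n. \<Sum>s<n. \<Sum>a<n. \<Sum>b<n. y r a s b) = real (n^2)"

lemma block_index_cases:
  assumes "p < n ^ 2"
  obtains r a where "p = r * n + a" "r < n" "a < (n :: nat)"
proof -
  have "n > 0" using assms by (cases n) auto
  moreover have "p div n < n"
    using assms by (simp add: power2_eq_square less_mult_imp_div_less)
  ultimately show ?thesis
    using that[of "p div n" "p mod n"] by simp
qed

lemma all_square_blocks:
  "(\<forall>p<n^2. Q p) \<longleftrightarrow> (\<forall>r<n. \<forall>a<n. Q (r * n + a))" for n :: nat
  by (metis block_index_cases block_index_less power2_eq_square)

lemma psd_square_blocks:
  fixes Y :: "real mat"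
  shows "(\<forall>w. 0 \<le> (\<Sum>p<n^2. \<Sum>q<n^2. w p * w q * Y $$ (p, q))) \<longleftrightarrow>
    (\<forall>v. 0 \<le> (\<Sum>r<n. \<Sum>s<n. \<Sum>a<n. \<Sum>b<n. v r a * v s b * block n Y r a s b))"
proof (intro iffI allI)
  fix v :: "nat \<Rightarrow> nat \<Rightarrow> real"
  assume "\<forall>w. 0 \<le> (\<Sum>p<n^2. \<Sum>q<n^2. w p * w q * Y $$ (p, q))"
  then have "0 \<le> (\<Sum>p<n^2. \<Sum>q<n^2. v (p div n) (p mod n) * v (q div n) (q mod n) * Y $$ (p, q))"
    by (rule allE[of _ "\<lambda>p. v (p div n) (p mod n)"]) simp
  then show "0 \<le> (\<Sum>r<n. \<Sum>s<n. \<Sum>a<n. \<Sum>b<n. v r a * v s b * block n Y r a s b)"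
    by (simp add: sum_square_blocks block_def)
next
  fix w :: "nat \<Rightarrow> real"
  assume "\<forall>v. 0 \<le> (\<Sum>r<n. \<Sum>s<n. \<Sum>a<n. \<Sum>b<n. v r a * v s b * block n Y r a s b)"
  then have "0 \<le> (\<Sum>r<n. \<Sum>s<n. \<Sum>a<n. \<Sum>b<n. w (r * n + a) * w (s * n + b) * block n Y r a s b)"
    by (rule allE[of _ "\<lambda>r a. w (r * n + a)"]) simp
  then show "0 \<le> (\<Sum>p<n^2. \<Sum>q<n^2. w p * w q * Y $$ (p, q))"
    by (simp add: sum_square_blocks block_def)
qed

text \<open>The relaxation has one equation for all forbidden entries; together with nonnegativity
  it forces each of them to vanish.\<close>

lemma sum4_eq_0_iff:
  fixes f :: "nat \<Rightarrow> nat \<Rightarrow> nat \<Rightarrow> nat \<Rightarrow> real"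
  assumes "\<And>r s a b. r < n \<Longrightarrow> s < n \<Longrightarrow> a < n \<Longrightarrow> b < n \<Longrightarrow> 0 \<le> f r s a b"
  shows "(\<Sum>r<n. \<Sum>s<n. \<Sum>a<n. \<Sum>b<n. f r s a b) = 0 \<longleftrightarrow> (\<forall>r<n. \<forall>s<n. \<forall>a<n. \<forall>b<n. f r s a b = 0)"
proof -
  have *: "(\<Sum>i<n. g i) = 0 \<longleftrightarrow> (\<forall>i<n. g i = 0)" if "\<And>i. i < n \<Longrightarrow> 0 \<le> g i" for g :: "nat \<Rightarrow> real"
    using that by (subst sum_nonneg_eq_0_iff) auto
  have 1: "0 \<le> (\<Sum>b<n. f r s a b)" if "r < n" "s < n" "a < n" for r s a
    using that by (intro sum_nonneg assms) auto
  have 2: "0 \<le> (\<Sum>a<n. \<Sum>b<n. f r s a b)" if "r < n" "s < n" for r s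
    using that by (intro sum_nonneg 1) auto
  have 3: "0 \<le> (\<Sum>s<n. \<Sum>a<n. \<Sum>b<n. f r s a b)" if "r < n" for r
    using that by (intro sum_nonneg 2) auto
  show ?thesis
    by (simp add: * assms 1 2 3)
qed

lemma SDPQAP_feasible_iff:
  assumes Y: "Y \<in> carrier_mat (n^2) (n^2)"
  shows "Y \<in> SDPQAP_feasible n \<longleftrightarrow> qap_blocks n (block n Y)"
proof -
  let ?y = "block n Y"
  have sym: "(\<forall>p<n^2. \<forall>q<n^2. Y $$ (p, q) = Y $$ (q, p)) \<longleftrightarrow>
     (\<forall>r<n. \<forall>a<n. \<forall>s<n. \<forall>b<n. ?y r a s b = ?y s b r a)"
    by (simp add: all_square_blocks block_def)
  have nonneg: "(\<forall>p<n^2. \<forall>q<n^2. 0 \<le> Y $$ (p, q)) \<longleftrightarrow> (\<forall>r<n. \<forall>a<n. \<forall>s<n. \<forall>b<n. 0 \<le> ?y r a s b)"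
    by (simp add: all_square_blocks block_def)
  have particle: "mat_inner (1\<^sub>m n \<otimes>\<^sub>K E_mat n j) Y = (\<Sum>r<n. ?y r j r j)" if "j < n" for j
  proof -
    \<comment> \<open>Nested conditionals let the sums collapse one index at a time.\<close>
    have "mat_inner (1\<^sub>m n \<otimes>\<^sub>K E_mat n j) Y =
      (\<Sum>r<n. \<Sum>s<n. \<Sum>a<n. \<Sum>b<n. if r = s then if a = j then if b = j then ?y r a s b else 0 else 0 else 0)"
      by (subst inner_kronecker[OF _ _ Y]) (auto simp: E_mat_def intro!: sum.cong)
    also have "\<dots> = (\<Sum>r<n. \<Sum>s<n. if r = s then \<Sum>a<n. \<Sum>b<n. if a = j then if b = j then ?y r a s b else 0 else 0 else 0)"
      by (intro sum.cong refl) simp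
    also have "\<dots> = (\<Sum>r<n. \<Sum>a<n. \<Sum>b<n. if a = j then if b = j then ?y r a r b else 0 else 0)"
      by simp
    also have "\<dots> = (\<Sum>r<n. \<Sum>a<n. if a = j then \<Sum>b<n. if b = j then ?y r a r b else 0 else 0)"
      by (intro sum.cong refl) simp
    finally show ?thesis using that by simp
  qed
  have point: "mat_inner (E_mat n j \<otimes>\<^sub>K 1\<^sub>m n) Y = (\<Sum>a<n. ?y j a j a)" if "j < n" for j
  proof -
    have "mat_inner (E_mat n j \<otimes>\<^sub>K 1\<^sub>m n) Y =
      (\<Sum>r<n. \<Sum>s<n. \<Sum>a<n. \<Sum>b<n. if r = j then if s = j then if a = b then ?y r a s b else 0 else 0 else 0)"
      by (subst inner_kronecker[OF _ _ Y]) (auto simp: E_mat_def intro!: sum.cong)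
    also have "\<dots> = (\<Sum>r<n. \<Sum>s<n. if r = j then if s = j then \<Sum>a<n. \<Sum>b<n. if a = b then ?y r a s b else 0 else 0 else 0)"
      by (intro sum.cong refl) simp
    also have "\<dots> = (\<Sum>r<n. if r = j then \<Sum>s<n. if s = j then \<Sum>a<n. \<Sum>b<n. if a = b then ?y r a s b else 0 else 0 else 0)"
      by (intro sum.cong refl) simp
    finally show ?thesis using that by simp
  qed
  have zero: "mat_inner (1\<^sub>m n \<otimes>\<^sub>K (J_mat n - 1\<^sub>m n) + (J_mat n - 1\<^sub>m n) \<otimes>\<^sub>K 1\<^sub>m n) Y = 0 \<longleftrightarrow>
     (\<forall>r<n. \<forall>a<n. \<forall>b<n. a \<noteq> b \<longrightarrow> ?y r a r b = 0) \<and> (\<forall>r<n. \<forall>a<n. \<forall>s<n. r \<noteq> s \<longrightarrow> ?y r a s a = 0)"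
    if nn: "\<forall>r<n. \<forall>a<n. \<forall>s<n. \<forall>b<n. 0 \<le> ?y r a s b"
  proof -
    let ?X = "1\<^sub>m n \<otimes>\<^sub>K (J_mat n - 1\<^sub>m n)" and ?Z = "(J_mat n - 1\<^sub>m n) \<otimes>\<^sub>K 1\<^sub>m n"
    have car: "?X \<in> carrier_mat (n^2) (n^2)" "?Z \<in> carrier_mat (n^2) (n^2)" "J_mat n - 1\<^sub>m n \<in> carrier_mat n n"
      by (auto simp: kronecker_def J_mat_def power2_eq_square intro!: carrier_matI)
    have "mat_inner (?X + ?Z) Y = mat_inner ?X Y + mat_inner ?Z Y"
      using car by (simp add: mat_inner_eq[OF _ Y] distrib_right sum.distrib)
    also have "\<dots> = (\<Sum>r<n. \<Sum>s<n. \<Sum>a<n. \<Sum>b<n. if r = s \<and> a \<noteq> b \<or> r \<noteq> s \<and> a = b then ?y r a s b else 0)"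
      unfolding inner_kronecker[OF one_carrier_mat car(3) Y] inner_kronecker[OF car(3) one_carrier_mat Y]
        sum.distrib[symmetric]
      by (intro sum.cong refl) (auto simp: J_mat_def)
    finally have inner: "mat_inner (?X + ?Z) Y = (\<Sum>r<n. \<Sum>s<n. \<Sum>a<n. \<Sum>b<n. if r = s \<and> a \<noteq> b \<or> r \<noteq> s \<and> a = b then ?y r a s b else 0)" .
    have "(\<Sum>r<n. \<Sum>s<n. \<Sum>a<n. \<Sum>b<n. if r = s \<and> a \<noteq> b \<or> r \<noteq> s \<and> a = b then ?y r a s b else 0) = 0 \<longleftrightarrow> (\<forall>r<n. \<forall>s<n. \<forall>a<n. \<forall>b<n. (if r = s \<and> a \<noteq> b \<or> r \<noteq> s \<and> a = b then ?y r a s b else 0) = 0)"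
      using nn by (intro sum4_eq_0_iff) auto
    also have "\<dots> \<longleftrightarrow> (\<forall>r<n. \<forall>a<n. \<forall>b<n. a \<noteq> b \<longrightarrow> ?y r a r b = 0) \<and> (\<forall>r<n. \<forall>a<n. \<forall>s<n. r \<noteq> s \<longrightarrow> ?y r a s a = 0)"
      (is "?L \<longleftrightarrow> ?R")
    proof
      assume L: ?L
      have "?y r a s b = 0" if "r < n" "s < n" "a < n" "b < n" "r = s \<and> a \<noteq> b \<or> r \<noteq> s \<and> a = b" for r s a b
        using L[THEN spec, THEN mp, OF that(1), THEN spec, THEN mp, OF that(2),
          THEN spec, THEN mp, OF that(3), THEN spec, THEN mp, OF that(4)] that(5) by simp
      then show ?R by simp
    next
      assume R: ?R
      show ?L
      proof (intro allI impI)
        fix r s a b assume "r < n" "s < n" "a < n" "b < n"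
        with R show "(if r = s \<and> a \<noteq> b \<or> r \<noteq> s \<and> a = b then ?y r a s b else 0) = 0"
          by (cases "r = s"; cases "a = b") simp_all
      qed
    qed
    finally show ?thesis unfolding inner .
  qed
  have J: "mat_inner (J_mat (n^2)) Y = (\<Sum>r<n. \<Sum>s<n. \<Sum>a<n. \<Sum>b<n. ?y r a s b)"
    by (simp add: mat_inner_eq[OF _ Y] J_mat_def sum_square_blocks block_def block_index_less[unfolded power2_eq_square[symmetric]])
  show ?thesis
    unfolding SDPQAP_feasible_def qap_blocks_def mem_Collect_eq psd_mat_iff[OF Y] psd_square_blocks sym nonneg J
    using Y zero particle point by (auto cong: conj_cong)
qed

lemma qap_blocks_cong:
  assumes "\<And>r a s b. r < n \<Longrightarrow> a < n \<Longrightarrow> s < n \<Longrightarrow> b < n \<Longrightarrow> y r a s b = z r a s b"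
  shows "qap_blocks n y \<longleftrightarrow> qap_blocks n z"
  unfolding qap_blocks_def using assms by (simp cong: sum.cong_simp)

lemma qap_blocks_realize:
  assumes "qap_blocks n y"
  obtains Y where "Y \<in> SDPQAP_feasible n"
    "\<forall>r<n. \<forall>a<n. \<forall>s<n. \<forall>b<n. block n Y r a s b = y r a s b"
proof
  let ?Y = "mat (n^2) (n^2) (\<lambda>(p, q). y (p div n) (p mod n) (q div n) (q mod n))"
  show *: "\<forall>r<n. \<forall>a<n. \<forall>s<n. \<forall>b<n. block n ?Y r a s b = y r a s b"
    by (simp add: block_mat)
  have "qap_blocks n (block n ?Y) \<longleftrightarrow> qap_blocks n y"
    by (rule qap_blocks_cong) (simp add: *)
  then show "?Y \<in> SDPQAP_feasible n"
    using assms by (simp add: SDPQAP_feasible_iff)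
qed

lemma psd_mat_2_iff:
  fixes p q r :: real
  shows "psd_mat (mat_of_rows_list 2 [[u, 0], [0, w]] + mat_of_rows_list 2 [[p, q], [q, r]]) \<longleftrightarrow>
    (\<forall>\<alpha> \<beta>. 0 \<le> \<alpha>^2 * (u + p) + 2 * \<alpha> * \<beta> * q + \<beta>^2 * (w + r))" (is "psd_mat ?M \<longleftrightarrow> ?R")
proof -
  have M: "?M \<in> carrier_mat 2 2"
    unfolding mat_of_rows_list_def by (simp add: numeral_2_eq_2)
  have entries: "?M $$ (0, 0) = u + p" "?M $$ (0, 1) = q" "?M $$ (1, 0) = q" "?M $$ (1, 1) = w + r"
    by (simp_all add: mat_of_rows_list_def)
  have q: "(\<Sum>i<2. \<Sum>j<2. v i * v j * ?M $$ (i, j)) =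
      (v 0)^2 * (u + p) + 2 * v 0 * v 1 * q + (v 1)^2 * (w + r)" for v :: "nat \<Rightarrow> real"
    using entries by (simp add: numeral_2_eq_2 lessThan_Suc power2_eq_square algebra_simps)
  have "(\<forall>v :: nat \<Rightarrow> real. 0 \<le> (v 0)^2 * (u + p) + 2 * v 0 * v 1 * q + (v 1)^2 * (w + r)) \<longleftrightarrow> ?R"
  proof (intro iffI allI)
    fix \<alpha> \<beta> :: real
    assume "\<forall>v :: nat \<Rightarrow> real. 0 \<le> (v 0)^2 * (u + p) + 2 * v 0 * v 1 * q + (v 1)^2 * (w + r)"
    from spec[OF this, of "\<lambda>i. if i = 0 then \<alpha> else \<beta>"]
    show "0 \<le> \<alpha>^2 * (u + p) + 2 * \<alpha> * \<beta> * q + \<beta>^2 * (w + r)" by simp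
  qed blast
  moreover have "\<forall>i<2. \<forall>j<2. ?M $$ (i, j) = ?M $$ (j, i)"
    using entries by (auto simp: less_2_cases_iff)
  ultimately show ?thesis
    unfolding psd_mat_iff[OF M] q by blast
qed

section \<open>Matrices constant on colour blocks\<close>

lemma sum_lessThan_split:
  fixes f :: "nat \<Rightarrow> real"
  assumes "m \<le> n"
  shows "(\<Sum>a<n. f a) = (\<Sum>a<m. f a) + (\<Sum>a=m..<n. f a)"
  using assms by (metis atLeast0LessThan le0 sum.atLeastLessThan_concat)

text \<open>The matrix is \<open>(u - p) I + p J\<close> on \<open>A\<close>, so the form depends
  only on the sum of the \<open>w a\<close> and the sum of their squares.\<close>

lemma sum_diag_const:
  fixes w :: "'a \<Rightarrow> real"
  assumes "finite A"
  shows "(\<Sum>a\<in>A. \<Sum>b\<in>A. w a * w b * (if a = b then u else p)) = p * (\<Sum>a\<in>A. w a)^2 + (u - p) * (\<Sum>a\<in>A. (w a)^2)"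
proof -
  have "w a * w b * (if a = b then u else p) = p * (w a * w b) + (if a = b then (u - p) * (w a)^2 else 0)" for a b
    by (simp add: power2_eq_square algebra_simps)
  then have "(\<Sum>a\<in>A. \<Sum>b\<in>A. w a * w b * (if a = b then u else p)) =
      (\<Sum>a\<in>A. \<Sum>b\<in>A. p * (w a * w b)) + (\<Sum>a\<in>A. \<Sum>b\<in>A. if a = b then (u - p) * (w a)^2 else 0)"
    by (simp add: sum.distrib)
  also have "(\<Sum>a\<in>A. \<Sum>b\<in>A. p * (w a * w b)) = p * (\<Sum>a\<in>A. w a)^2"
    unfolding power2_eq_square sum_product by (simp only: sum_distrib_left)
  also have "(\<Sum>a\<in>A. \<Sum>b\<in>A. if a = b then (u - p) * (w a)^2 else 0) = (u - p) * (\<Sum>a\<in>A. (w a)^2)"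
    using assms by (simp add: sum_distrib_left)
  finally show ?thesis .
qed

text \<open>The left side is the form at the constant vector with the mean of \<open>w\<close>.
  Averaging lowers the form by Cauchy-Schwarz, because the coefficient
  \<open>u - p / (M (M - 1))\<close> of the sum of squares is nonnegative. For empty
  \<open>A\<close> both sides are 0.\<close>

lemma diag_const_lower_bound:
  fixes w :: "'a \<Rightarrow> real" and u p :: real
  defines "M \<equiv> \<lambda>A :: 'a set. real (card A)"
  assumes A: "finite A" and "p \<le> M A * (M A - 1) * u" and "M A = 1 \<Longrightarrow> p = 0" and "0 \<le> u"
  shows "((\<Sum>a\<in>A. w a) / M A)^2 * (M A * u + p) \<le>
    (\<Sum>a\<in>A. \<Sum>b\<in>A. w a * w b * (if a = b then u else p / (M A * (M A - 1))))"
proof (cases "card A = 0")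
  case True
  then show ?thesis using A by (simp add: M_def)
next
  case False
  define M' where "M' = M A"
  define p' where "p' = p / (M' * (M' - 1))"
  define S where "S = (\<Sum>a\<in>A. w a)"
  define T where "T = (\<Sum>a\<in>A. (w a)^2)"
  have M1: "M' = 1 \<or> M' \<ge> 2"
    using False by (cases "card A = 1") (auto simp: M'_def M_def)
  \<comment> \<open>For \<open>M' = 1\<close> the quotient is 0 by division by zero, and
    \<open>p = 0\<close> by assumption.\<close>
  have p': "p' * (M' - 1) * M' = p"
    using M1 assms by (auto simp: p'_def M'_def)
  have "p' \<le> u"
  proof (cases "M' = 1")
    case True
    then show ?thesis using assms by (simp add: p'_def)
  next
    case False
    then have "0 < M' * (M' - 1)" using M1 by simp
    then show ?thesis
      using assms(3) unfolding p'_def by (simp add: pos_divide_le_eq M'_def mult.commute)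
  qed
  moreover have "S^2 / M' \<le> T"
    using sum_squared_le_sum_of_squares[of w A] M1 by (auto simp: S_def T_def M'_def M_def pos_divide_le_eq mult.commute)
  ultimately have "(u - p') * (S^2 / M') \<le> (u - p') * T"
    by (intro mult_left_mono) auto
  moreover have "(S / M')^2 * (M' * u + p) = p' * S^2 + (u - p') * (S^2 / M')"
  proof -
    have "M' \<noteq> 0" using M1 by auto
    then show ?thesis unfolding p'[symmetric] by (simp add: field_simps power2_eq_square)
  qed
  ultimately show ?thesis
    unfolding M'_def[symmetric] p'_def[symmetric] sum_diag_const[OF A] S_def[symmetric] T_def[symmetric] by simp
qed

text \<open>If a colour has at most one particle, a denominator vanishes and the quotient is \<open>0\<close>; the program
  then forces the corresponding numerator to vanish as well.\<close>

definition colour_weight :: "nat \<Rightarrow> nat \<Rightarrow> real \<Rightarrow> real \<Rightarrow> real \<Rightarrow> real \<Rightarrow> nat \<Rightarrow> nat \<Rightarrow> real" where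
  "colour_weight n m u pb pw q a b =
     (if a = b then u
      else if a < m \<and> b < m then pb / (real m * (real m - 1))
      else if m \<le> a \<and> m \<le> b then pw / (real (n - m) * (real (n - m) - 1))
      else q / (2 * real m * real (n - m)))"

text \<open>The two mixed rectangles have the same constant entries and see only the sums of
  \<open>w\<close> over the colours. \<open>q\<close> counts black-white and white-black together,
  hence the factor 2 in its denominator.\<close>

lemma sum_colour_weight:
  assumes "m \<le> n"
  shows "(\<Sum>a<n. \<Sum>b<n. w a * w b * colour_weight n m u pb pw q a b) =
    (\<Sum>a<m. \<Sum>b<m. w a * w b * (if a = b then u else pb / (real m * (real m - 1)))) +
    (\<Sum>a<m. w a) / real m * ((\<Sum>a=m..<n. w a) / real (n - m)) * q +
    (\<Sum>a=m..<n. \<Sum>b=m..<n. w a * w b * (if a = b then u else pw / (real (n - m) * (real (n - m) - 1))))"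
proof -
  let ?g = "\<lambda>a b. w a * w b * colour_weight n m u pb pw q a b"
  have "(\<Sum>a<n. \<Sum>b<n. ?g a b) = (\<Sum>a<m. \<Sum>b<m. ?g a b) + (\<Sum>a<m. \<Sum>b=m..<n. ?g a b)
      + (\<Sum>a=m..<n. \<Sum>b<m. ?g a b) + (\<Sum>a=m..<n. \<Sum>b=m..<n. ?g a b)"
    by (simp add: sum_lessThan_split[OF assms] sum.distrib)
  also have "(\<Sum>a<m. \<Sum>b<m. ?g a b) = (\<Sum>a<m. \<Sum>b<m. w a * w b * (if a = b then u else pb / (real m * (real m - 1))))"
    by (intro sum.cong refl) (simp add: colour_weight_def)
  also have "(\<Sum>a=m..<n. \<Sum>b=m..<n. ?g a b) =
      (\<Sum>a=m..<n. \<Sum>b=m..<n. w a * w b * (if a = b then u else pw / (real (n - m) * (real (n - m) - 1))))"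
    by (intro sum.cong refl) (simp add: colour_weight_def)
  also have "(\<Sum>a<m. \<Sum>b=m..<n. ?g a b) = (\<Sum>a<m. \<Sum>b=m..<n. w a * w b * (q / (2 * real m * real (n - m))))"
    by (intro sum.cong refl) (simp add: colour_weight_def)
  also have "(\<Sum>a=m..<n. \<Sum>b<m. ?g a b) = (\<Sum>a=m..<n. \<Sum>b<m. w a * w b * (q / (2 * real m * real (n - m))))"
    by (intro sum.cong refl) (simp add: colour_weight_def)
  also have "(\<Sum>a<m. \<Sum>b=m..<n. w a * w b * (q / (2 * real m * real (n - m)))) =
      (\<Sum>a<m. w a) * (\<Sum>a=m..<n. w a) * (q / (2 * real m * real (n - m)))"
    by (simp only: sum_distrib_right[symmetric] sum_product)
  also have "(\<Sum>a=m..<n. \<Sum>b<m. w a * w b * (q / (2 * real m * real (n - m)))) =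
      (\<Sum>a=m..<n. w a) * (\<Sum>a<m. w a) * (q / (2 * real m * real (n - m)))"
    by (simp only: sum_distrib_right[symmetric] sum_product)
  \<comment> \<open>Valid for an empty colour as well: both sides are then 0 by division by
    zero.\<close>
  moreover have "x * y * (q / (2 * c * k)) + y * x * (q / (2 * c * k)) = x / c * (y / k) * q" for x y c k :: real
    by (cases "c = 0"; cases "k = 0") (simp_all add: field_simps)
  note this[of "\<Sum>a<m. w a" "\<Sum>a=m..<n. w a" "real m" "real (n - m)"]
  ultimately show ?thesis by linarith
qed

text \<open>Replacing \<open>w\<close> by its mean on each colour lowers the two diagonal blocks and
  keeps the mixed term; what remains is the 2x2 form at the two means.\<close>

lemma colour_weight_psd:
  assumes "m \<le> n" "0 \<le> u"
    and quad: "\<And>\<alpha> \<beta>. 0 \<le> \<alpha>^2 * (real m * u + pb) + \<alpha> * \<beta> * q + \<beta>^2 * (real (n - m) * u + pw)"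
    and pb: "pb \<le> real m * (real m - 1) * u" "m = 1 \<Longrightarrow> pb = 0"
    and pw: "pw \<le> real (n - m) * (real (n - m) - 1) * u" "n - m = 1 \<Longrightarrow> pw = 0"
  shows "0 \<le> (\<Sum>a<n. \<Sum>b<n. w a * w b * colour_weight n m u pb pw q a b)"
proof -
  have "((\<Sum>a<m. w a) / real m)^2 * (real m * u + pb) \<le>
      (\<Sum>a<m. \<Sum>b<m. w a * w b * (if a = b then u else pb / (real m * (real m - 1))))"
    using diag_const_lower_bound[of "{..<m}" pb u w, unfolded card_lessThan] pb assms(2) by simp
  moreover have "((\<Sum>a=m..<n. w a) / real (n - m))^2 * (real (n - m) * u + pw) \<le>
      (\<Sum>a=m..<n. \<Sum>b=m..<n. w a * w b * (if a = b then u else pw / (real (n - m) * (real (n - m) - 1))))"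
    using diag_const_lower_bound[of "{m..<n}" pw u w, unfolded card_atLeastLessThan] pw assms(2) by simp
  ultimately show ?thesis
    unfolding sum_colour_weight[OF assms(1)]
    using quad[of "(\<Sum>a<m. w a) / real m" "(\<Sum>a=m..<n. w a) / real (n - m)"] by linarith
qed

text \<open>There are \<open>M * (M - 1)\<close> off-diagonal pairs. For \<open>M \<le> 1\<close>
  there are none, hence the side condition.\<close>

lemma sum_diag_zero:
  assumes "finite A" "card A \<le> 1 \<Longrightarrow> p = 0"
  shows "(\<Sum>a\<in>A. \<Sum>b\<in>A. if a = b then 0 else p / (real (card A) * (real (card A) - 1))) = p"
proof (cases "card A \<le> 1")
  case True
  then show ?thesis using assms by (simp cong: if_cong)
next
  case False
  define M where "M = real (card A)"
  define p' where "p' = p / (M * (M - 1))"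
  have "M \<ge> 2" using False by (simp add: M_def)
  then have p': "p = p' * (M * (M - 1))" by (simp add: p'_def)
  have "(\<Sum>a\<in>A. \<Sum>b\<in>A. if a = b then 0 else p') = p' * M^2 - p' * M"
    using sum_diag_const[OF assms(1), of "\<lambda>_. 1" 0 p'] by (simp add: M_def)
  also have "\<dots> = p" unfolding p' by (simp add: algebra_simps power2_eq_square)
  finally show ?thesis unfolding p'_def M_def .
qed

lemma sum_colour_weight_black:
  assumes "m \<le> 1 \<Longrightarrow> pb = 0"
  shows "(\<Sum>a<m. \<Sum>b<m. colour_weight n m 0 pb pw q a b) = pb"
proof -
  have "(\<Sum>a<m. \<Sum>b<m. colour_weight n m 0 pb pw q a b) = (\<Sum>a<m. \<Sum>b<m. if a = b then 0 else pb / (real m * (real m - 1)))"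
    by (intro sum.cong refl) (simp add: colour_weight_def)
  then show ?thesis using sum_diag_zero[of "{..<m}" pb, unfolded card_lessThan] assms by simp
qed

lemma sum_colour_weight_all:
  assumes "1 \<le> m" "m \<le> n" "m = 1 \<Longrightarrow> pb = 0" "n - m \<le> 1 \<Longrightarrow> pw = 0" "n = m \<Longrightarrow> q = 0"
  shows "(\<Sum>a<n. \<Sum>b<n. colour_weight n m 0 pb pw q a b) = pb + pw + q"
  using sum_colour_weight[OF assms(2), of "\<lambda>_. 1" 0 pb pw q]
    sum_diag_zero[of "{..<m}" pb, unfolded card_lessThan] sum_diag_zero[of "{m..<n}" pw, unfolded card_atLeastLessThan] assms
  by (cases "n = m") (auto cong: if_cong)

lemma colour_weight_nonneg:
  assumes "0 \<le> u" "0 \<le> pb" "0 \<le> pw" "0 \<le> q"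
  shows "0 \<le> colour_weight n m u pb pw q a b"
proof -
  have "0 \<le> real k * (real k - 1)" for k :: nat
    by (cases k) simp_all
  then show ?thesis using assms by (simp add: colour_weight_def)
qed

text \<open>For fixed nonzero \<open>\<alpha>\<close> the form is affine in \<open>\<beta>\<close>,
  so it is unbounded below unless \<open>q = 0\<close>.\<close>

lemma quadratic_cross_term_zero:
  fixes A q :: real
  assumes "\<And>\<alpha> \<beta>. 0 \<le> \<alpha>^2 * A + \<alpha> * \<beta> * q"
  shows "q = 0"
proof (rule ccontr)
  assume "q \<noteq> 0"
  \<comment> \<open>This choice gives the form the value -1.\<close>
  with assms[of 1 "- (A + 1) / q"] show False by simp
qed

section \<open>The two directions\<close>

context torus_grid
begin

text \<open>A cosine transform of the class values; every constraint of the program involves the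
  variables through it or through their plain sum and signs.\<close>

definition tsum :: "nat \<Rightarrow> nat \<Rightarrow> (nat \<Rightarrow> nat \<Rightarrow> real) \<Rightarrow> real" where
  "tsum k l y = (\<Sum>(i, j)\<in>P. d k l i j * y i j)"

text \<open>The factor 1/2 of the off-diagonal entries cancels the 2 of the quadratic form, which
  leaves \<open>\<alpha> * \<beta>\<close> with coefficient \<open>tsum k l ybw\<close>.\<close>

lemma torus_sdp_feasible_iff:
  assumes "m \<le> n"
  shows "(ybb, yww, ybw) \<in> torus_sdp_feasible n1 n2 m \<longleftrightarrow>
    (\<Sum>(i, j)\<in>P. ybb i j + yww i j + ybw i j) = real n - 1 \<and>
    (\<forall>k\<le>n1 div 2. \<forall>l\<le>n2 div 2.
      (\<forall>\<alpha> \<beta>. 0 \<le> \<alpha>^2 * (real m / real n + tsum k l ybb) + \<alpha> * \<beta> * tsum k l ybw +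
                \<beta>^2 * (real (n - m) / real n + tsum k l yww)) \<and>
      tsum k l ybb \<le> real m * (real m - 1) / real n \<and>
      tsum k l yww \<le> real (n - m) * (real (n - m) - 1) / real n) \<and>
    (\<forall>(i, j)\<in>P. 0 \<le> ybb i j \<and> 0 \<le> yww i j \<and> 0 \<le> ybw i j)"
proof -
  have half: "(\<Sum>(i, j)\<in>P. d k l i j * (1 / 2 * ybw i j)) = tsum k l ybw / 2" for k l
    by (simp add: tsum_def sum_divide_distrib case_prod_unfold)
  then show ?thesis
    using of_nat_diff[OF assms, where ?'a = real]
    unfolding torus_sdp_feasible_def Let_def mem_Collect_eq prod.case psd_mat_2_iff half
    by (simp add: tsum_def[symmetric] mult.assoc)
qed

text \<open>Reflecting \<open>k\<close> to \<open>n1 - k\<close> turns the angle at an integer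
  \<open>i\<close> into \<open>2 * pi * i\<close> minus the old one, with the same cosine. The
  folded frequency serves all families \<open>y\<close> at once.\<close>

lemma tsum_fold:
  assumes "k < n1" "l < n2"
  obtains k' l' where "k' \<le> n1 div 2" "l' \<le> n2 div 2" "\<And>y. tsum k l y = tsum k' l' y"
proof -
  have reflect: "cos (2 * pi * real (q - k) * real i / real q) = cos (2 * pi * real k * real i / real q)" if "k < q" for k q i
  proof -
    have "2 * pi * real (q - k) * real i / real q = 2 * pi * real_of_int (int i) - 2 * pi * real k * real i / real q"
      using that by (simp add: of_nat_diff field_simps)
    then show ?thesis
      by (simp only: cos_diff cos_int_2pin sin_int_2pin)
  qed
  define k' where "k' = (if k \<le> n1 div 2 then k else n1 - k)"
  define l' where "l' = (if l \<le> n2 div 2 then l else n2 - l)"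
  show ?thesis
  proof
    show "k' \<le> n1 div 2" "l' \<le> n2 div 2" by (auto simp: k'_def l'_def)
    show "tsum k l y = tsum k' l' y" for y
      using assms by (simp add: tsum_def torus_d_def k'_def l'_def reflect del: of_nat_diff)
  qed
qed

lemma tsum_0: "tsum 0 0 y = (\<Sum>(i, j)\<in>P. y i j)"
  by (simp add: tsum_def torus_d_def)

lemma mat_inner_energy:
  assumes Y: "Y \<in> carrier_mat (n^2) (n^2)" and "m \<le> n"
  shows "mat_inner (energy_B n1 n2 \<otimes>\<^sub>K energy_A n m) Y =
    (\<Sum>r<n. \<Sum>s<n. 1 / real (fst (cls r s) + snd (cls r s)) * (\<Sum>a<m. \<Sum>b<m. block n Y r a s b))"
proof -
  \<comment> \<open>On the diagonal the class is \<open>(0, 0)\<close>, and \<open>1 / 0 = 0\<close>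
    agrees with the zero diagonal of \<open>energy_B\<close>.\<close>
  have B: "energy_B n1 n2 $$ (r, s) = 1 / real (fst (cls r s) + snd (cls r s))" if "r < n" "s < n" for r s
  proof (cases "r = s")
    case True
    then have "cls r s = (0, 0)" using cls_eq_0_iff[OF that] by simp
    then show ?thesis using True that by (simp add: energy_B_def)
  next
    case False
    then show ?thesis
      using that lee_dist_grid_point[OF that, of "fst (cls r s)" "snd (cls r s)"] by (simp add: energy_B_def)
  qed
  have A: "(\<Sum>a<n. \<Sum>b<n. e * energy_A n m $$ (a, b) * f a b) = e * (\<Sum>a<m. \<Sum>b<m. f a b)" for e f
  proof -
    have "(\<Sum>a<n. \<Sum>b<n. e * energy_A n m $$ (a, b) * f a b) = (\<Sum>a<n. \<Sum>b<n. if a < m then if b < m then e * f a b else 0 else 0)"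
      by (intro sum.cong refl) (simp add: energy_A_def)
    also have "\<dots> = (\<Sum>a<m. \<Sum>b<m. e * f a b)"
      by (simp add: sum_lessThan_split[OF assms(2)])
    finally show ?thesis by (simp add: sum_distrib_left)
  qed
  have car: "energy_B n1 n2 \<in> carrier_mat n n" "energy_A n m \<in> carrier_mat n n"
    by (simp_all add: energy_A_def energy_B_def)
  show ?thesis
    unfolding inner_kronecker[OF car Y] by (intro sum.cong refl) (simp only: A B lessThan_iff)
qed

lemma agg_add: "agg (\<lambda>r s. F r s + G r s) c = agg F c + agg G c"
  by (simp add: agg_def case_prod_unfold sum.distrib)

section \<open>From the relaxation to the small program: class sums of a block matrix\<close>

lemma torus_point_of_qap_blocks:
  assumes y: "qap_blocks n y" and m: "m \<le> n"
  obtains ybb yww ybw where "(ybb, yww, ybw) \<in> torus_sdp_feasible n1 n2 m"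
    "torus_sdp_objective n1 n2 ybb =
      (\<Sum>r<n. \<Sum>s<n. 1 / real (fst (cls r s) + snd (cls r s)) * (\<Sum>a<m. \<Sum>b<m. y r a s b))"
proof -
  define N where "N = real n"
  have N: "N > 0" using n_pos by (simp add: N_def)
  have psd: "\<And>v. 0 \<le> (\<Sum>r<n. \<Sum>s<n. \<Sum>a<n. \<Sum>b<n. v r a * v s b * y r a s b)"
    and nonneg: "\<And>r a s b. r < n \<Longrightarrow> a < n \<Longrightarrow> s < n \<Longrightarrow> b < n \<Longrightarrow> 0 \<le> y r a s b"
    and particle: "\<And>a. a < n \<Longrightarrow> (\<Sum>r<n. y r a r a) = 1"
    and zero1: "\<And>r a b. r < n \<Longrightarrow> a < n \<Longrightarrow> b < n \<Longrightarrow> a \<noteq> b \<Longrightarrow> y r a r b = 0"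
    and zero2: "\<And>r a s. r < n \<Longrightarrow> a < n \<Longrightarrow> s < n \<Longrightarrow> r \<noteq> s \<Longrightarrow> y r a s a = 0"
    and total: "(\<Sum>r<n. \<Sum>s<n. \<Sum>a<n. \<Sum>b<n. y r a s b) = N^2"
    using y by (simp_all add: qap_blocks_def N_def)
  define T where "T A B r s = (\<Sum>a\<in>A. \<Sum>b\<in>B. y r a s b)" for A B :: "nat set" and r s
  let ?b = "{..<m}" and ?w = "{m..<n}"
  \<comment> \<open>Division by \<open>N\<close> matches the factor \<open>n\<close> in the
    objective. \<open>ybw\<close> collects both directions of a mixed pair.\<close>
  define ybb where "ybb i j = agg (T ?b ?b) (i, j) / N" for i j
  define yww where "yww i j = agg (T ?w ?w) (i, j) / N" for i j
  define ybw where "ybw i j = agg (\<lambda>r s. T ?b ?w r s + T ?w ?b r s) (i, j) / N" for i j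

  have T_nonneg: "0 \<le> T A B r s" if "A \<subseteq> {..<n}" "B \<subseteq> {..<n}" "r < n" "s < n" for A B r s
    unfolding T_def using that by (intro sum_nonneg nonneg) auto
  have agg_nonneg: "0 \<le> agg G c" if "\<And>r s. r < n \<Longrightarrow> s < n \<Longrightarrow> 0 \<le> G r s" for G c
    unfolding agg_def using that by (intro sum_nonneg) auto
  \<comment> \<open>At one grid point only equal particles give nonzero entries, and each particle
    has total diagonal 1; so the trace counts the common particles. This is the origin of
    \<open>m\<close> and \<open>n - m\<close>.\<close>
  have diag: "(\<Sum>r<n. T A B r r) = real (card (A \<inter> B))" if "A \<subseteq> {..<n}" "B \<subseteq> {..<n}" for A B
  proof -
    have fin: "finite A" "finite B" using that finite_subset by blast+
    have "T A B r r = (\<Sum>a\<in>A \<inter> B. y r a r a)" if "r < n" for r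
    proof -
      have "T A B r r = (\<Sum>a\<in>A. \<Sum>b\<in>B. if a = b then y r a r a else 0)"
        unfolding T_def using that \<open>A \<subseteq> _\<close> \<open>B \<subseteq> _\<close> by (intro sum.cong refl) (auto intro!: zero1)
      also have "\<dots> = (\<Sum>a\<in>A. if a \<in> B then y r a r a else 0)"
        using fin by simp
      finally show ?thesis using fin by (simp add: sum.inter_restrict)
    qed
    then have "(\<Sum>r<n. T A B r r) = (\<Sum>r<n. \<Sum>a\<in>A \<inter> B. y r a r a)" by simp
    also have "\<dots> = (\<Sum>a\<in>A \<inter> B. \<Sum>r<n. y r a r a)" by (rule sum.swap)
    also have "\<dots> = (\<Sum>a\<in>A \<inter> B. 1)" using that by (intro sum.cong refl particle) auto
    finally show ?thesis by simp
  qed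
  have sub: "?b \<subseteq> {..<n}" "?w \<subseteq> {..<n}" "?b \<inter> ?w = {}" "?w \<inter> ?b = {}"
    using m by auto
  have diags: "(\<Sum>r<n. T ?b ?b r r) = real m" "(\<Sum>r<n. T ?w ?w r r) = real (n - m)"
    "(\<Sum>r<n. T ?b ?w r r) = 0" "(\<Sum>r<n. T ?w ?b r r) = 0"
    using diag[OF sub(1,1)] diag[OF sub(2,2)] diag[OF sub(1,2)] diag[OF sub(2,1)]
    unfolding sub Int_absorb by simp_all
  have kern_cls: "kern k l r s = d k l (fst (cls r s)) (snd (cls r s))" if "r < n" "s < n" for k l r s
    using kern_eq_d[OF that] by simp
  \<comment> \<open>The kernel is 1 on the diagonal, which therefore contributes the plain
    trace.\<close>
  have kern_sum: "(\<Sum>r<n. \<Sum>s<n. kern k l r s * G r s) = (\<Sum>r<n. G r r) + N * tsum k l (\<lambda>i j. agg G (i, j) / N)" for k l G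
  proof -
    have "(\<Sum>r<n. \<Sum>s<n. kern k l r s * G r s) = d k l 0 0 * (\<Sum>r<n. G r r) + (\<Sum>c\<in>P. d k l (fst c) (snd c) * agg G c)"
      by (subst sum_cls[where F = "\<lambda>c. d k l (fst c) (snd c)" and G = G]) (simp_all add: kern_cls)
    then show ?thesis
      using N by (simp add: tsum_def torus_d_def sum_distrib_left case_prod_unfold)
  qed
  have sum_eq: "(\<Sum>(i, j)\<in>P. ybb i j + yww i j + ybw i j) = N - 1"
  proof -
    have "N^2 = (\<Sum>r<n. \<Sum>s<n. 1 * (T ?b ?b r s + T ?w ?w r s + (T ?b ?w r s + T ?w ?b r s)))"
      unfolding total[symmetric] T_def
      by (intro sum.cong refl) (simp add: sum_lessThan_split[OF m] sum.distrib)
    also have "\<dots> = (\<Sum>r<n. T ?b ?b r r + T ?w ?w r r + (T ?b ?w r r + T ?w ?b r r)) +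
       (\<Sum>c\<in>P. agg (\<lambda>r s. T ?b ?b r s + T ?w ?w r s + (T ?b ?w r s + T ?w ?b r s)) c)"
      by (subst sum_cls[where F = "\<lambda>_. 1"]) simp_all
    also have "(\<Sum>r<n. T ?b ?b r r + T ?w ?w r r + (T ?b ?w r r + T ?w ?b r r)) = N"
      using of_nat_diff[OF m, where ?'a = real] by (simp add: sum.distrib diags N_def del: of_nat_diff)
    also have "(\<Sum>c\<in>P. agg (\<lambda>r s. T ?b ?b r s + T ?w ?w r s + (T ?b ?w r s + T ?w ?b r s)) c) =
       N * (\<Sum>(i, j)\<in>P. ybb i j + yww i j + ybw i j)"
      using N by (simp add: sum_distrib_left case_prod_unfold ybb_def yww_def ybw_def agg_add distrib_left add_divide_distrib)
    finally have "N * (N - 1) = N * (\<Sum>(i, j)\<in>P. ybb i j + yww i j + ybw i j)"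
      by (simp add: power2_eq_square algebra_simps)
    then show ?thesis using N by simp
  qed
  have quad: "0 \<le> \<alpha>^2 * (real m / N + tsum k l ybb) + \<alpha> * \<beta> * tsum k l ybw + \<beta>^2 * (real (n - m) / N + tsum k l yww)" for \<alpha> \<beta> k l
  proof -
    define g where "g a = (if a < m then \<alpha> else \<beta>)" for a
    have g: "(\<Sum>a<n. \<Sum>b<n. g a * g b * y r a s b) =
      \<alpha>^2 * T ?b ?b r s + \<alpha> * \<beta> * (T ?b ?w r s + T ?w ?b r s) + \<beta>^2 * T ?w ?w r s" for r s
      by (simp add: g_def sum_lessThan_split[OF m] sum.distrib T_def sum_distrib_left power2_eq_square algebra_simps)
    have "0 \<le> (\<Sum>r<n. \<Sum>s<n. kern k l r s * (\<Sum>a<n. \<Sum>b<n. g a * g b * y r a s b))"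
      by (rule kern_sum_nonneg[OF psd])
    also have "\<dots> = \<alpha>^2 * (\<Sum>r<n. \<Sum>s<n. kern k l r s * T ?b ?b r s) +
       \<alpha> * \<beta> * (\<Sum>r<n. \<Sum>s<n. kern k l r s * (T ?b ?w r s + T ?w ?b r s)) +
       \<beta>^2 * (\<Sum>r<n. \<Sum>s<n. kern k l r s * T ?w ?w r s)"
      unfolding g by (simp add: distrib_left sum.distrib sum_distrib_left mult_ac)
    also have "\<dots> = N * (\<alpha>^2 * (real m / N + tsum k l ybb) + \<alpha> * \<beta> * tsum k l ybw + \<beta>^2 * (real (n - m) / N + tsum k l yww))"
      using N unfolding kern_sum ybb_def[abs_def] yww_def[abs_def] ybw_def[abs_def] by (simp add: sum.distrib diags field_simps)
    finally show ?thesis using N by (simp add: zero_le_mult_iff)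
  qed
  have bound: "tsum k l (\<lambda>i j. agg (T A A) (i, j) / N) \<le> real (card A) * (real (card A) - 1) / N" if A: "A \<subseteq> {..<n}" for A k l
  proof -
    \<comment> \<open>test vector \<open>f(r) (e\<^sub>a - e\<^sub>b)\<close>\<close>
    have pair: "0 \<le> (\<Sum>r<n. \<Sum>s<n. kern k l r s * (y r a s a + y r b s b - y r a s b - y r b s a))" if "a \<in> A" "b \<in> A" for a b
    proof -
      have ab: "a < n" "b < n" using subsetD[OF A that(1)] subsetD[OF A that(2)] by simp_all
      have g: "(\<Sum>i<n. f i * (of_bool (i = a) - of_bool (i = b))) = f a - f b" for f :: "nat \<Rightarrow> real"
        using ab by (simp add: right_diff_distrib sum_subtractf of_bool_def if_distrib[of "(*) _"] cong: if_cong)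
      have "(\<Sum>i<n. \<Sum>j<n. (of_bool (i = a) - of_bool (i = b)) * (of_bool (j = a) - of_bool (j = b)) * y r i s j) =
         (\<Sum>i<n. (\<Sum>j<n. y r i s j * (of_bool (j = a) - of_bool (j = b))) * (of_bool (i = a) - of_bool (i = b)))" for r s
        by (simp add: sum_distrib_left sum_distrib_right mult_ac)
      then have "(\<Sum>i<n. \<Sum>j<n. (of_bool (i = a) - of_bool (i = b)) * (of_bool (j = a) - of_bool (j = b)) * y r i s j) =
         y r a s a + y r b s b - y r a s b - y r b s a" for r s
        by (simp add: g)
      then show ?thesis
        using kern_sum_nonneg[OF psd, of k l "\<lambda>i. of_bool (i = a) - of_bool (i = b)"] by simp
    qed
    \<comment> \<open>With M the size of \<open>A\<close>, adding the inequalities over all ordered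
      pairs yields \<open>2 * M * M - 2 * (M + N * tsum)\<close> as a nonnegative quantity, which is
      the claimed bound.\<close>
    have "0 \<le> (\<Sum>a\<in>A. \<Sum>b\<in>A. \<Sum>r<n. \<Sum>s<n. kern k l r s * (y r a s a + y r b s b - y r a s b - y r b s a))"
      by (rule sum_nonneg, rule sum_nonneg, rule pair)
    also have "\<dots> = 2 * (real (card A) * (\<Sum>a\<in>A. \<Sum>r<n. \<Sum>s<n. kern k l r s * y r a s a))
        - 2 * (\<Sum>a\<in>A. \<Sum>b\<in>A. \<Sum>r<n. \<Sum>s<n. kern k l r s * y r a s b)"
    proof -
      define h where "h a b = (\<Sum>r<n. \<Sum>s<n. kern k l r s * y r a s b)" for a b
      have "(\<Sum>a\<in>A. \<Sum>b\<in>A. \<Sum>r<n. \<Sum>s<n. kern k l r s * (y r a s a + y r b s b - y r a s b - y r b s a)) =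
         (\<Sum>a\<in>A. \<Sum>b\<in>A. h a a + h b b - h a b - h b a)"
        by (simp add: h_def distrib_left right_diff_distrib sum.distrib sum_subtractf)
      also have "\<dots> = (\<Sum>a\<in>A. \<Sum>b\<in>A. h a a) + (\<Sum>a\<in>A. \<Sum>b\<in>A. h b b) - (\<Sum>a\<in>A. \<Sum>b\<in>A. h a b) - (\<Sum>a\<in>A. \<Sum>b\<in>A. h b a)"
        by (simp only: sum.distrib sum_subtractf)
      also have "(\<Sum>a\<in>A. \<Sum>b\<in>A. h b a) = (\<Sum>a\<in>A. \<Sum>b\<in>A. h a b)"
        by (rule sum.swap)
      finally show ?thesis
        unfolding h_def[symmetric] by (simp add: sum_distrib_left[symmetric])
    qed
    also have "(\<Sum>a\<in>A. \<Sum>r<n. \<Sum>s<n. kern k l r s * y r a s a) = real (card A)"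
    proof -
      \<comment> \<open>Entries with \<open>r \<noteq> s\<close> vanish for a single particle, and
        the kernel is 1 on the diagonal; what is left is the unit trace of particle
        \<open>a\<close>.\<close>
      have "(\<Sum>r<n. \<Sum>s<n. kern k l r s * y r a s a) = 1" if "a \<in> A" for a
      proof -
        have a: "a < n" using that A by auto
        have "(\<Sum>r<n. \<Sum>s<n. kern k l r s * y r a s a) = (\<Sum>r<n. \<Sum>s<n. if r = s then y r a r a else 0)"
          by (intro sum.cong refl) (auto simp: zero2 a kern_def)
        then show ?thesis by (simp add: particle a)
      qed
      then show ?thesis by simp
    qed
    also have "(\<Sum>a\<in>A. \<Sum>b\<in>A. \<Sum>r<n. \<Sum>s<n. kern k l r s * y r a s b) = (\<Sum>r<n. \<Sum>s<n. kern k l r s * T A A r s)"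
    proof -
      have "(\<Sum>a\<in>A. \<Sum>b\<in>A. \<Sum>r<n. \<Sum>s<n. kern k l r s * y r a s b) = (\<Sum>a\<in>A. \<Sum>r<n. \<Sum>b\<in>A. \<Sum>s<n. kern k l r s * y r a s b)"
        by (intro sum.cong refl sum.swap)
      also have "\<dots> = (\<Sum>r<n. \<Sum>a\<in>A. \<Sum>b\<in>A. \<Sum>s<n. kern k l r s * y r a s b)"
        by (rule sum.swap)
      also have "\<dots> = (\<Sum>r<n. \<Sum>a\<in>A. \<Sum>s<n. \<Sum>b\<in>A. kern k l r s * y r a s b)"
        by (intro sum.cong refl sum.swap)
      also have "\<dots> = (\<Sum>r<n. \<Sum>s<n. \<Sum>a\<in>A. \<Sum>b\<in>A. kern k l r s * y r a s b)"
        by (intro sum.cong refl sum.swap)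
      finally show ?thesis by (simp add: T_def sum_distrib_left)
    qed
    also have "\<dots> = real (card A) + N * tsum k l (\<lambda>i j. agg (T A A) (i, j) / N)"
      by (simp add: kern_sum diag A)
    finally show ?thesis
      using N by (simp add: pos_le_divide_eq algebra_simps)
  qed
  have "(ybb, yww, ybw) \<in> torus_sdp_feasible n1 n2 m"
    unfolding torus_sdp_feasible_iff[OF m] N_def[symmetric]
  proof (intro conjI allI impI)
    show "tsum k l ybb \<le> real m * (real m - 1) / N" for k l
      using bound[OF sub(1), of k l, unfolded card_lessThan] unfolding ybb_def[abs_def] by auto
    show "tsum k l yww \<le> real (n - m) * (real (n - m) - 1) / N" for k l
      using bound[OF sub(2), of k l, unfolded card_atLeastLessThan] unfolding yww_def[abs_def] by auto
    show "\<forall>(i, j)\<in>P. 0 \<le> ybb i j \<and> 0 \<le> yww i j \<and> 0 \<le> ybw i j"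
      unfolding ybb_def yww_def ybw_def using N m
      by (auto intro!: divide_nonneg_pos agg_nonneg T_nonneg add_nonneg_nonneg)
  qed (use sum_eq quad in auto)
  \<comment> \<open>The diagonal class drops out because its weight is
    \<open>1 / 0 = 0\<close>.\<close>
  moreover have "torus_sdp_objective n1 n2 ybb =
      (\<Sum>r<n. \<Sum>s<n. 1 / real (fst (cls r s) + snd (cls r s)) * (\<Sum>a<m. \<Sum>b<m. y r a s b))"
    using N by (subst sum_cls[where F = "\<lambda>c. 1 / real (fst c + snd c)" and G = "T ?b ?b"])
      (simp_all add: torus_sdp_objective_def N_def[symmetric] ybb_def T_def sum_distrib_left case_prod_unfold del: of_nat_mult)
  ultimately show ?thesis using that by blast
qed

section \<open>From the small program to the relaxation: Fourier synthesis\<close>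

text \<open>By reflection the constraints extend to every frequency that occurs in the Fourier
  inversion.\<close>

lemma torus_sdp_feasibleD:
  assumes feas: "(ybb, yww, ybw) \<in> torus_sdp_feasible n1 n2 m" and m: "m \<le> n" and kl: "k < n1" "l < n2"
  shows "0 \<le> \<alpha>^2 * (real m / real n + tsum k l ybb) + \<alpha> * \<beta> * tsum k l ybw + \<beta>^2 * (real (n - m) / real n + tsum k l yww)"
    and "tsum k l ybb \<le> real m * (real m - 1) / real n"
    and "tsum k l yww \<le> real (n - m) * (real (n - m) - 1) / real n"
proof -
  obtain k' l' where kl': "k' \<le> n1 div 2" "l' \<le> n2 div 2" "\<And>y. tsum k l y = tsum k' l' y"
    using tsum_fold[OF kl] by blast
  have all: "(\<forall>\<alpha> \<beta>. 0 \<le> \<alpha>^2 * (real m / real n + tsum k l ybb) + \<alpha> * \<beta> * tsum k l ybw +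
                \<beta>^2 * (real (n - m) / real n + tsum k l yww)) \<and>
      tsum k l ybb \<le> real m * (real m - 1) / real n \<and>
      tsum k l yww \<le> real (n - m) * (real (n - m) - 1) / real n"
    unfolding kl'(3) using feas kl'(1,2) unfolding torus_sdp_feasible_iff[OF m] by blast
  from all show "0 \<le> \<alpha>^2 * (real m / real n + tsum k l ybb) + \<alpha> * \<beta> * tsum k l ybw + \<beta>^2 * (real (n - m) / real n + tsum k l yww)"
    by blast
  from all show "tsum k l ybb \<le> real m * (real m - 1) / real n"
    and "tsum k l yww \<le> real (n - m) * (real (n - m) - 1) / real n"
    by blast+
qed

text \<open>At frequency zero \<open>tsum\<close> is the plain sum. This eliminates the variables of
  colour combinations that contain no pair of distinct particles.\<close>

lemma tsum_0_eq_0D: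
  assumes "\<And>c. c \<in> P \<Longrightarrow> 0 \<le> y (fst c) (snd c)" "tsum 0 0 y \<le> 0" "c \<in> P"
  shows "y (fst c) (snd c) = 0"
proof -
  have "(\<Sum>c\<in>P. y (fst c) (snd c)) \<le> 0"
    using assms(2) by (simp add: tsum_0 case_prod_unfold)
  moreover have "0 \<le> (\<Sum>c\<in>P. y (fst c) (snd c))"
    using assms(1) by (simp add: sum_nonneg)
  ultimately have "(\<Sum>c\<in>P. y (fst c) (snd c)) = 0"
    by linarith
  then show ?thesis
    using sum_nonneg_eq_0_iff[OF finite_P, of "\<lambda>c. y (fst c) (snd c)"] assms(1,3) by blast
qed

lemma qap_blocks_of_torus_point:
  assumes feas: "(ybb, yww, ybw) \<in> torus_sdp_feasible n1 n2 m" and m: "1 \<le> m" "m \<le> n"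
  obtains y where "qap_blocks n y"
    "(\<Sum>r<n. \<Sum>s<n. 1 / real (fst (cls r s) + snd (cls r s)) * (\<Sum>a<m. \<Sum>b<m. y r a s b)) =
       torus_sdp_objective n1 n2 ybb"
proof -
  define N where "N = real n"
  have N: "N > 0" using n_pos by (simp add: N_def)
  have nonneg: "0 \<le> ybb (fst c) (snd c)" "0 \<le> yww (fst c) (snd c)" "0 \<le> ybw (fst c) (snd c)" if "c \<in> P" for c
  proof -
    have "\<forall>c\<in>P. 0 \<le> ybb (fst c) (snd c) \<and> 0 \<le> yww (fst c) (snd c) \<and> 0 \<le> ybw (fst c) (snd c)"
      using feas unfolding torus_sdp_feasible_iff[OF m(2)] case_prod_unfold by blast
    with that show "0 \<le> ybb (fst c) (snd c)" "0 \<le> yww (fst c) (snd c)" "0 \<le> ybw (fst c) (snd c)" by simp_all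
  qed
  define tot where "tot c = ybb (fst c) (snd c) + yww (fst c) (snd c) + ybw (fst c) (snd c)" for c
  have total: "(\<Sum>c\<in>P. tot c) = N - 1"
    using feas unfolding torus_sdp_feasible_iff[OF m(2)] N_def tot_def case_prod_unfold by blast
  note D = torus_sdp_feasibleD[OF feas m(2), folded N_def]
  \<comment> \<open>For \<open>m = 1\<close> the bound \<open>m * (m - 1) / n\<close> is 0 at
    frequency zero.\<close>
  have ybb0: "ybb (fst c) (snd c) = 0" if "m = 1" "c \<in> P" for c
    using D(2)[OF n1_pos n2_pos] that nonneg by (intro tsum_0_eq_0D) auto
  have yww0: "yww (fst c) (snd c) = 0" if "n - m \<le> 1" "c \<in> P" for c
  proof (rule tsum_0_eq_0D[where y = yww])
    have "n - m = 0 \<or> n - m = 1" using that by linarith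
    then have "real (n - m) * (real (n - m) - 1) = 0" by (elim disjE) simp_all
    with D(3)[OF n1_pos n2_pos] show "tsum 0 0 yww \<le> 0"
      by (simp only: div_0)
  qed (use that nonneg in auto)
  have tsum_yww0: "tsum k l yww = 0" if "n - m \<le> 1" for k l
    using yww0[OF that] by (simp add: tsum_def case_prod_unfold)
  have tsum_ybb0: "tsum k l ybb = 0" if "m = 1" for k l
    using ybb0[OF that] by (simp add: tsum_def case_prod_unfold)
  \<comment> \<open>Without white particles the white diagonal entry of the 2x2 matrix is 0, and
    semidefiniteness forces the off-diagonal entry to vanish.\<close>
  have ybw0: "ybw (fst c) (snd c) = 0" if "n = m" "c \<in> P" for c
  proof (rule tsum_0_eq_0D[where y = ybw])
    have "0 \<le> \<alpha>^2 * (real m / N + tsum 0 0 ybb) + \<alpha> * \<beta> * tsum 0 0 ybw" for \<alpha> \<beta>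
      using D(1)[OF n1_pos n2_pos, of \<alpha> \<beta>] tsum_yww0[of 0 0] that(1) by simp
    then have "tsum 0 0 ybw = 0"
      by (rule quadratic_cross_term_zero)
    then show "tsum 0 0 ybw \<le> 0" by simp
  qed (use that nonneg in auto)

  define W where "W c = colour_weight n m 0 (ybb (fst c) (snd c)) (yww (fst c) (snd c)) (ybw (fst c) (snd c))" for c
  \<comment> \<open>\<open>proj (0, 0)\<close> is the identity on the grid, so the first term puts
    \<open>1 / N\<close> on the diagonal. The weights \<open>W\<close> have zero diagonal, and since
    each \<open>proj c\<close> has total \<open>n\<close>, the class sums come out as
    prescribed.\<close>
  define y where "y r a s b = (if a = b then proj (0, 0) r s / N else 0) + (\<Sum>c\<in>P. W c a b * proj c r s)" for r a s b
  have W_nonneg: "0 \<le> W c a b" if "c \<in> P" for c a b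
    unfolding W_def using nonneg[OF that] by (intro colour_weight_nonneg) simp_all
  have W_diag: "W c a a = 0" for c a
    by (simp add: W_def colour_weight_def)
  \<comment> \<open>\<open>colour_weight\<close> is linear in its four parameters, so the transform
    can be taken inside, with \<open>u = 1 / N\<close> coming from the diagonal term.\<close>
  have W_tsum: "colour_weight n m (1 / N) (tsum k l ybb) (tsum k l yww) (tsum k l ybw) a b =
      (if a = b then 1 / N else 0) + (\<Sum>c\<in>P. W c a b * d k l (fst c) (snd c))" for k l a b
    by (cases "a = b"; cases "a < m"; cases "b < m")
      (simp_all add: W_def colour_weight_def tsum_def case_prod_unfold sum_divide_distrib mult.commute not_less)
  have proj_d: "proj c r s = (\<Sum>k<n1. \<Sum>l<n2. d k l (fst c) (snd c) * kern k l r s) / N" for c r s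
    using proj_kern[of "fst c" "snd c" r s] by (simp add: N_def)
  \<comment> \<open>In this form semidefiniteness of \<open>y\<close> reduces to one colour matrix
    per frequency.\<close>
  have y_kern: "y r a s b = (\<Sum>k<n1. \<Sum>l<n2. kern k l r s *
      (colour_weight n m (1 / N) (tsum k l ybb) (tsum k l yww) (tsum k l ybw) a b / N))" for r a s b
  proof -
    have "(\<Sum>c\<in>P. W c a b * proj c r s) = (\<Sum>c\<in>P. \<Sum>k<n1. \<Sum>l<n2. kern k l r s * (W c a b * d k l (fst c) (snd c) / N))"
      unfolding proj_d sum_divide_distrib sum_distrib_left by (intro sum.cong refl) (simp add: mult_ac)
    also have "\<dots> = (\<Sum>k<n1. \<Sum>c\<in>P. \<Sum>l<n2. kern k l r s * (W c a b * d k l (fst c) (snd c) / N))"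
      by (rule sum.swap)
    also have "\<dots> = (\<Sum>k<n1. \<Sum>l<n2. \<Sum>c\<in>P. kern k l r s * (W c a b * d k l (fst c) (snd c) / N))"
      by (intro sum.cong refl sum.swap)
    finally have 1: "(\<Sum>c\<in>P. W c a b * proj c r s) =
       (\<Sum>k<n1. \<Sum>l<n2. kern k l r s * ((\<Sum>c\<in>P. W c a b * d k l (fst c) (snd c)) / N))"
      by (simp add: sum_distrib_left sum_divide_distrib)
    have 2: "(if a = b then proj (0, 0) r s / N else 0) = (\<Sum>k<n1. \<Sum>l<n2. kern k l r s * ((if a = b then 1 / N else 0) / N))"
      unfolding proj_d by (simp add: torus_d_def sum_divide_distrib)
    show ?thesis
      unfolding y_def W_tsum 1 2 by (simp add: sum.distrib[symmetric] add_divide_distrib distrib_left)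
  qed
  have psd: "0 \<le> (\<Sum>r<n. \<Sum>s<n. \<Sum>a<n. \<Sum>b<n. v r a * v s b * y r a s b)" for v
    unfolding y_kern
  proof (rule kern_combination_psd)
    fix k l w assume kl: "k < n1" "l < n2"
    have "0 \<le> (\<Sum>a<n. \<Sum>b<n. w a * w b * colour_weight n m (1 / N) (tsum k l ybb) (tsum k l yww) (tsum k l ybw) a b)"
      using N D[OF kl] tsum_ybb0 tsum_yww0 by (intro colour_weight_psd m) auto
    then have "0 \<le> (\<Sum>a<n. \<Sum>b<n. w a * w b * colour_weight n m (1 / N) (tsum k l ybb) (tsum k l yww) (tsum k l ybw) a b) / N"
      using N by simp
    then show "0 \<le> (\<Sum>a<n. \<Sum>b<n. w a * w b * (colour_weight n m (1 / N) (tsum k l ybb) (tsum k l yww) (tsum k l ybw) a b / N))"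
      by (simp add: sum_divide_distrib)
  qed
  have proj_diag: "proj c r r = 0" if "c \<in> P" "r < n" for c r
    using that cls_eq_0_iff[of r r] zero_notin_P by (intro proj_eq_0) auto
  have diag: "y r a r b = (if a = b then 1 / N else 0)" if "r < n" for r a b
    using that by (simp add: y_def proj_0 proj_diag)
  have y_nonneg: "0 \<le> y r a s b" for r a s b
    unfolding y_def using N by (auto intro!: add_nonneg_nonneg sum_nonneg mult_nonneg_nonneg W_nonneg proj_nonneg divide_nonneg_pos)
  have W_sym: "W c a b = W c b a" for c a b
    unfolding W_def colour_weight_def by (cases "a = b"; cases "a < m"; cases "b < m") simp_all
  have proj_sym: "proj c r s = proj c s r" for c r s
    unfolding proj_def by (simp only: circ_proj_commute[of _ _ "r div n2"] circ_proj_commute[of _ _ "r mod n2"])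
  have block_sum: "(\<Sum>a\<in>A. \<Sum>b\<in>A. y r a s b) = real (card A) * (proj (0, 0) r s / N) + (\<Sum>c\<in>P. (\<Sum>a\<in>A. \<Sum>b\<in>A. W c a b) * proj c r s)"
    if "finite A" for A r s
  proof -
    have "(\<Sum>a\<in>A. \<Sum>b\<in>A. \<Sum>c\<in>P. W c a b * proj c r s) = (\<Sum>a\<in>A. \<Sum>c\<in>P. \<Sum>b\<in>A. W c a b * proj c r s)"
      by (intro sum.cong refl sum.swap)
    also have "\<dots> = (\<Sum>c\<in>P. \<Sum>a\<in>A. \<Sum>b\<in>A. W c a b * proj c r s)"
      by (rule sum.swap)
    finally show ?thesis
      using that by (simp add: y_def sum.distrib sum_distrib_right)
  qed
  have sum_rs: "(\<Sum>r<n. \<Sum>s<n. \<Sum>c\<in>P. G c * proj c r s) = N * (\<Sum>c\<in>P. G c)" for G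
  proof -
    have "(\<Sum>r<n. \<Sum>s<n. \<Sum>c\<in>P. G c * proj c r s) = (\<Sum>r<n. \<Sum>c\<in>P. \<Sum>s<n. G c * proj c r s)"
      by (intro sum.cong refl sum.swap)
    also have "\<dots> = (\<Sum>c\<in>P. \<Sum>r<n. \<Sum>s<n. G c * proj c r s)"
      by (rule sum.swap)
    finally show ?thesis
      using sum_proj by (simp add: sum_distrib_left[symmetric] N_def sum_distrib_right[symmetric] mult.commute)
  qed
  have "qap_blocks n y"
    unfolding qap_blocks_def
  proof (intro conjI allI impI)
    show "y r a s b = y s b r a" for r a s b
      unfolding y_def by (subst W_sym, subst (1 2) proj_sym) simp
    show "(\<Sum>r<n. y r a r a) = 1" for a
      using n1_pos n2_pos by (simp add: diag N_def)
    show "(\<Sum>a<n. y r a r a) = 1" if "r < n" for r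
      using n1_pos n2_pos that by (simp add: diag N_def)
    show "y r a s a = 0" if "r < n" "s < n" "r \<noteq> s" for r s a
      using that by (simp add: y_def W_diag proj_0)
    have "(\<Sum>a<n. \<Sum>b<n. W c a b) = tot c" if "c \<in> P" for c
      unfolding W_def tot_def using m ybb0 yww0 ybw0 that by (intro sum_colour_weight_all) auto
    then have "(\<Sum>r<n. \<Sum>s<n. \<Sum>a<n. \<Sum>b<n. y r a s b) =
      (\<Sum>r<n. \<Sum>s<n. proj (0, 0) r s + (\<Sum>c\<in>P. tot c * proj c r s))"
      using N by (intro sum.cong refl) (simp add: block_sum N_def[symmetric] del: of_nat_mult)
    also have "\<dots> = N + N * (N - 1)"
      unfolding sum.distrib sum_rs total using sum_proj[of "(0, 0)"] by (simp add: N_def)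
    also have "\<dots> = real (n^2)"
      by (simp add: N_def power2_eq_square algebra_simps)
    finally show "(\<Sum>r<n. \<Sum>s<n. \<Sum>a<n. \<Sum>b<n. y r a s b) = real (n^2)" .
  qed (use psd y_nonneg diag in auto)
  moreover have "(\<Sum>r<n. \<Sum>s<n. 1 / real (fst (cls r s) + snd (cls r s)) * (\<Sum>a<m. \<Sum>b<m. y r a s b)) =
       torus_sdp_objective n1 n2 ybb"
  proof -
    have W_black: "(\<Sum>a<m. \<Sum>b<m. W c a b) = ybb (fst c) (snd c)" if "c \<in> P" for c
      unfolding W_def using m ybb0 that by (intro sum_colour_weight_black) auto
    have "1 / real (fst (cls r s) + snd (cls r s)) * (\<Sum>a<m. \<Sum>b<m. y r a s b) =
       (\<Sum>c\<in>P. ybb (fst c) (snd c) / real (fst c + snd c) * proj c r s)" if "r < n" "s < n" for r s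
    proof -
      define e where "e = 1 / real (fst (cls r s) + snd (cls r s))"
      \<comment> \<open>Either \<open>r \<noteq> s\<close> and the projection is 0, or
        \<open>r = s\<close> and \<open>e = 1 / 0 = 0\<close>.\<close>
      have "e * proj (0, 0) r s = 0"
        unfolding e_def using that cls_eq_0_iff[OF that] by (cases "r = s") (simp_all add: proj_0)
      \<comment> \<open>The weight is constant on the support of \<open>proj c\<close>, so it may be
        replaced by its value on the class \<open>c\<close>.\<close>
      moreover have "e * proj c r s = 1 / real (fst c + snd c) * proj c r s" if "c \<in> P" for c
        unfolding e_def using proj_eq_0[OF \<open>r < n\<close> \<open>s < n\<close> that] by (cases "cls r s = c") auto
      moreover have "e * (\<Sum>a<m. \<Sum>b<m. y r a s b) =
          real m / N * (e * proj (0, 0) r s) + (\<Sum>c\<in>P. ybb (fst c) (snd c) * (e * proj c r s))"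
        by (simp add: block_sum W_black distrib_left sum_distrib_left mult_ac)
      ultimately have "e * (\<Sum>a<m. \<Sum>b<m. y r a s b) =
          (\<Sum>c\<in>P. ybb (fst c) (snd c) * (1 / real (fst c + snd c) * proj c r s))"
        by simp
      then show ?thesis
        unfolding e_def by simp
    qed
    then have "(\<Sum>r<n. \<Sum>s<n. 1 / real (fst (cls r s) + snd (cls r s)) * (\<Sum>a<m. \<Sum>b<m. y r a s b)) =
      (\<Sum>r<n. \<Sum>s<n. \<Sum>c\<in>P. ybb (fst c) (snd c) / real (fst c + snd c) * proj c r s)"
      by (intro sum.cong refl) simp
    then show ?thesis
      unfolding sum_rs by (simp add: torus_sdp_objective_def N_def case_prod_unfold)
  qed
  ultimately show ?thesis using that by blast
qed

end

section \<open>Attainment of the minimum\<close>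

lemma continuous_on_entry:
  fixes f :: "'a :: topological_space \<Rightarrow> 'b \<Rightarrow> 'c \<Rightarrow> real"
  assumes "continuous_on S f"
  shows "continuous_on S (\<lambda>x. f x i j)"
  by (rule continuous_on_product_then_coordinatewise)
    (rule continuous_on_product_then_coordinatewise[OF assms])

text \<open>Tychonoff, carried over from the abstract product topology to the topology of the
  function type.\<close>

lemma compact_PiE_UNIV:
  fixes S :: "'a \<Rightarrow> 'b :: topological_space set"
  assumes "\<And>i. compact (S i)"
  shows "compact (PiE UNIV S)"
proof -
  have "compactin (product_topology (\<lambda>_. euclidean) UNIV) (PiE UNIV S)"
    using assms by (simp add: compactin_PiE)
  then show ?thesis
    by (simp add: euclidean_product_topology)
qed

lemma compact_box: "compact {f :: nat \<Rightarrow> nat \<Rightarrow> real. \<forall>i j. f i j \<in> {0..N}}"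
proof -
  have "{f :: nat \<Rightarrow> nat \<Rightarrow> real. \<forall>i j. f i j \<in> {0..N}} = PiE UNIV (\<lambda>_. PiE UNIV (\<lambda>_. {0..N}))"
    by (auto simp: PiE_UNIV_domain Pi_def)
  then show ?thesis
    by (simp add: compact_PiE_UNIV)
qed

text \<open>The rank-one matrix of the assignment that puts particle \<open>a\<close> on grid point
  \<open>a\<close>; its quadratic form is a square. It shows that the relaxation is
  feasible.\<close>

lemma qap_blocks_identity: "qap_blocks n (\<lambda>r a s b. of_bool (r = a) * of_bool (s = b))"
proof -
  have quad: "(\<Sum>r<n. \<Sum>s<n. \<Sum>a<n. \<Sum>b<n. v r a * v s b * (of_bool (r = a) * of_bool (s = b))) = (\<Sum>r<n. v r r)^2"
    for v :: "nat \<Rightarrow> nat \<Rightarrow> real"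
  proof -
    have "(\<Sum>r<n. \<Sum>s<n. \<Sum>a<n. \<Sum>b<n. v r a * v s b * (of_bool (r = a) * of_bool (s = b))) =
      (\<Sum>r<n. \<Sum>s<n. \<Sum>a<n. \<Sum>b<n. if r = a then if s = b then v r a * v s b else 0 else 0)"
      by (intro sum.cong refl) auto
    also have "\<dots> = (\<Sum>r<n. \<Sum>s<n. \<Sum>a<n. if r = a then v r a * v s s else 0)"
      by (intro sum.cong refl) simp
    also have "\<dots> = (\<Sum>r<n. v r r)^2"
      by (simp add: power2_eq_square sum_product)
    finally show ?thesis .
  qed
  have one: "(\<Sum>r<n. of_bool (r = a) * of_bool (r = a)) = (1 :: real)" "(\<Sum>r<n. of_bool (a = r) * of_bool (a = r)) = (1 :: real)"
    if "a < n" for a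
  proof -
    have "(\<Sum>r<n. of_bool (r = a) * of_bool (r = a)) = (\<Sum>r<n. if r = a then 1 else (0 :: real))"
      by (intro sum.cong refl) simp
    then show "(\<Sum>r<n. of_bool (r = a) * of_bool (r = a)) = (1 :: real)"
      using that by simp
    then show "(\<Sum>r<n. of_bool (a = r) * of_bool (a = r)) = (1 :: real)"
      by (simp only: eq_commute[of a])
  qed
  show ?thesis
    unfolding qap_blocks_def
  proof (intro conjI allI impI)
    show "(\<Sum>r<n. \<Sum>s<n. \<Sum>a<n. \<Sum>b<n. of_bool (r = a) * of_bool (s = b)) = real (n^2)"
      using quad[of "\<lambda>_ _. 1"] by simp
  qed (auto simp: quad one simp del: of_bool_eq_1_iff)
qed

context torus_grid
begin

text \<open>Every constraint is a weak inequality or equation between continuous functions of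
  finitely many coordinates. The set is first rewritten with outer quantifiers so that it becomes an
  intersection of such conditions.\<close>

lemma closed_torus_sdp_feasible:
  assumes "m \<le> n"
  shows "closed (torus_sdp_feasible n1 n2 m)"
proof -
  have entry: "continuous_on UNIV (\<lambda>y :: (nat \<Rightarrow> nat \<Rightarrow> real) \<times> (nat \<Rightarrow> nat \<Rightarrow> real) \<times> (nat \<Rightarrow> nat \<Rightarrow> real). fst y i j)"
    "continuous_on UNIV (\<lambda>y :: (nat \<Rightarrow> nat \<Rightarrow> real) \<times> (nat \<Rightarrow> nat \<Rightarrow> real) \<times> (nat \<Rightarrow> nat \<Rightarrow> real). fst (snd y) i j)"
    "continuous_on UNIV (\<lambda>y :: (nat \<Rightarrow> nat \<Rightarrow> real) \<times> (nat \<Rightarrow> nat \<Rightarrow> real) \<times> (nat \<Rightarrow> nat \<Rightarrow> real). snd (snd y) i j)" for i j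
    by (intro continuous_on_entry continuous_intros)+
  have eq: "torus_sdp_feasible n1 n2 m = {y.
      (\<Sum>c\<in>P. fst y (fst c) (snd c) + fst (snd y) (fst c) (snd c) + snd (snd y) (fst c) (snd c)) = real n - 1 \<and>
      (\<forall>k l \<alpha> \<beta>. k \<le> n1 div 2 \<longrightarrow> l \<le> n2 div 2 \<longrightarrow>
        0 \<le> \<alpha>^2 * (real m / real n + tsum k l (fst y)) + \<alpha> * \<beta> * tsum k l (snd (snd y)) +
                \<beta>^2 * (real (n - m) / real n + tsum k l (fst (snd y)))) \<and>
      (\<forall>k l. k \<le> n1 div 2 \<longrightarrow> l \<le> n2 div 2 \<longrightarrow> tsum k l (fst y) \<le> real m * (real m - 1) / real n) \<and>
      (\<forall>k l. k \<le> n1 div 2 \<longrightarrow> l \<le> n2 div 2 \<longrightarrow> tsum k l (fst (snd y)) \<le> real (n - m) * (real (n - m) - 1) / real n) \<and>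
      (\<forall>c. c \<in> P \<longrightarrow> 0 \<le> fst y (fst c) (snd c)) \<and>
      (\<forall>c. c \<in> P \<longrightarrow> 0 \<le> fst (snd y) (fst c) (snd c)) \<and>
      (\<forall>c. c \<in> P \<longrightarrow> 0 \<le> snd (snd y) (fst c) (snd c))}" (is "_ = {y. ?Q y}")
  proof (rule Set.set_eqI)
    fix y :: "(nat \<Rightarrow> nat \<Rightarrow> real) \<times> (nat \<Rightarrow> nat \<Rightarrow> real) \<times> (nat \<Rightarrow> nat \<Rightarrow> real)"
    obtain ybb yww ybw where y: "y = (ybb, yww, ybw)" by (cases y) auto
    show "y \<in> torus_sdp_feasible n1 n2 m \<longleftrightarrow> y \<in> {y. ?Q y}"
      unfolding y torus_sdp_feasible_iff[OF assms] mem_Collect_eq fst_conv snd_conv case_prod_unfold by blast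
  qed
  show ?thesis
    unfolding eq tsum_def case_prod_unfold
    by (intro closed_Collect_conj closed_Collect_all closed_Collect_imp open_Collect_const
        closed_Collect_eq closed_Collect_le continuous_intros entry)
qed

text \<open>The variables are functions on all pairs of naturals and are unrestricted off
  \<open>torus_pairs\<close>, so the feasible set is not compact. Setting them to 0 there changes
  neither feasibility nor objective, and nonnegativity with the sum \<open>n - 1\<close> puts the
  rest into a box.\<close>

lemma torus_sdp_minimum:
  assumes m: "m \<le> n" and ne: "torus_sdp_feasible n1 n2 m \<noteq> {}"
  obtains y where "y \<in> torus_sdp_feasible n1 n2 m"
    "\<forall>z\<in>torus_sdp_feasible n1 n2 m. torus_sdp_objective n1 n2 (fst y) \<le> torus_sdp_objective n1 n2 (fst z)"
proof -
  let ?F = "torus_sdp_feasible n1 n2 m"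
  define K where "K = {f :: nat \<Rightarrow> nat \<Rightarrow> real. \<forall>i j. f i j \<in> {0..real n}}"
  define C where "C = (K \<times> K \<times> K) \<inter> ?F"
  have truncate: "\<exists>z'\<in>C. torus_sdp_objective n1 n2 (fst z') = torus_sdp_objective n1 n2 (fst z)" if z: "z \<in> ?F" for z
  proof -
    obtain ybb yww ybw where z_eq: "z = (ybb, yww, ybw)" by (cases z) auto
    define t where "t y i j = (if (i, j) \<in> P then y i j else 0)" for y :: "nat \<Rightarrow> nat \<Rightarrow> real" and i j
    have t: "t y i j = y i j" if "(i, j) \<in> P" for y i j using that by (simp add: t_def)
    have feas: "(ybb, yww, ybw) \<in> ?F" using z z_eq by simp
    have nonneg: "0 \<le> ybb i j" "0 \<le> yww i j" "0 \<le> ybw i j" if "(i, j) \<in> P" for i j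
      using feas that unfolding torus_sdp_feasible_iff[OF m] by blast+
    have sum: "(\<Sum>(i, j)\<in>P. ybb i j + yww i j + ybw i j) = real n - 1"
      using feas unfolding torus_sdp_feasible_iff[OF m] by blast
    have le: "ybb i j + yww i j + ybw i j \<le> real n" if "(i, j) \<in> P" for i j
    proof -
      have "(case (i, j) of (i, j) \<Rightarrow> ybb i j + yww i j + ybw i j) \<le> (\<Sum>(i, j)\<in>P. ybb i j + yww i j + ybw i j)"
        using that nonneg finite_P by (intro member_le_sum) (auto intro!: add_nonneg_nonneg)
      then show ?thesis unfolding sum by simp
    qed
    have "t ybb \<in> K" "t yww \<in> K" "t ybw \<in> K"
    proof -
      have "0 \<le> t ybb i j \<and> t ybb i j \<le> real n \<and> 0 \<le> t yww i j \<and> t yww i j \<le> real n \<and> 0 \<le> t ybw i j \<and> t ybw i j \<le> real n" for i j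
        using nonneg[of i j] le[of i j] by (cases "(i, j) \<in> P") (auto simp: t_def simp del: of_nat_mult)
      then show "t ybb \<in> K" "t yww \<in> K" "t ybw \<in> K"
        by (simp_all add: K_def del: of_nat_mult)
    qed
    moreover have "(t ybb, t yww, t ybw) \<in> ?F"
    proof -
      have tsum: "tsum k l (t y) = tsum k l y" for k l y
        unfolding tsum_def by (intro sum.cong refl) (auto simp: t)
      have "(\<Sum>(i, j)\<in>P. t ybb i j + t yww i j + t ybw i j) = real n - 1"
        unfolding sum[symmetric] by (intro sum.cong refl) (auto simp: t)
      moreover have "\<forall>(i, j)\<in>P. 0 \<le> t ybb i j \<and> 0 \<le> t yww i j \<and> 0 \<le> t ybw i j"
        using nonneg by (auto simp: t)
      ultimately show ?thesis
        using feas unfolding torus_sdp_feasible_iff[OF m] tsum by blast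
    qed
    moreover have "torus_sdp_objective n1 n2 (t ybb) = torus_sdp_objective n1 n2 ybb"
      unfolding torus_sdp_objective_def by (intro arg_cong2[where f = "(*)"] sum.cong refl) (auto simp: t)
    ultimately show ?thesis
      unfolding C_def z_eq by (intro bexI[of _ "(t ybb, t yww, t ybw)"]) auto
  qed
  have "compact C"
    unfolding C_def K_def
    by (intro compact_Int_closed compact_Times compact_box closed_torus_sdp_feasible m)
  moreover have "C \<noteq> {}" using ne truncate by blast
  moreover have "continuous_on C (\<lambda>y. torus_sdp_objective n1 n2 (fst y))"
    unfolding torus_sdp_objective_def case_prod_unfold divide_inverse
    by (intro continuous_intros continuous_on_entry)
  ultimately obtain y where y: "y \<in> C"
      "\<forall>z\<in>C. torus_sdp_objective n1 n2 (fst y) \<le> torus_sdp_objective n1 n2 (fst z)"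
    using continuous_attains_inf by blast
  show ?thesis
  proof (rule that)
    show "y \<in> ?F" using y(1) by (simp add: C_def)
    show "\<forall>z\<in>?F. torus_sdp_objective n1 n2 (fst y) \<le> torus_sdp_objective n1 n2 (fst z)"
      using truncate y(2) by metis
  qed
qed

text \<open>By \<open>down\<close> and \<open>up\<close> the two programs have the same set of
  objective values. A minimiser of the small program therefore determines the \<open>LEAST\<close>
  on one side and the infimum on the other.\<close>

lemma SDPQAP_eq_torus_sdp_value:
  assumes m: "1 \<le> m" "m \<le> n"
  shows "ereal (SDPQAP (energy_A n m) (energy_B n1 n2)) = torus_sdp_value n1 n2 m"
proof -
  let ?F = "torus_sdp_feasible n1 n2 m"
  let ?obj = "torus_sdp_objective n1 n2"
  let ?qap = "mat_inner (energy_B n1 n2 \<otimes>\<^sub>K energy_A n m)"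
  have down: "\<exists>z\<in>?F. ?obj (fst z) = ?qap Y" if Yf: "Y \<in> SDPQAP_feasible n" for Y
  proof -
    have Y: "Y \<in> carrier_mat (n^2) (n^2)"
      using Yf by (simp add: SDPQAP_feasible_def)
    obtain ybb yww ybw where "(ybb, yww, ybw) \<in> ?F"
      "?obj ybb = (\<Sum>r<n. \<Sum>s<n. 1 / real (fst (cls r s) + snd (cls r s)) * (\<Sum>a<m. \<Sum>b<m. block n Y r a s b))"
      by (rule torus_point_of_qap_blocks[OF Yf[unfolded SDPQAP_feasible_iff[OF Y]] m(2)])
    then show ?thesis
      unfolding mat_inner_energy[OF Y m(2)] by (intro bexI[of _ "(ybb, yww, ybw)"]) simp_all
  qed
  have up: "\<exists>Y\<in>SDPQAP_feasible n. ?qap Y = ?obj (fst z)" if z: "z \<in> ?F" for z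
  proof -
    obtain ybb yww ybw where z_eq: "z = (ybb, yww, ybw)" by (cases z) auto
    obtain y where y: "qap_blocks n y"
      "(\<Sum>r<n. \<Sum>s<n. 1 / real (fst (cls r s) + snd (cls r s)) * (\<Sum>a<m. \<Sum>b<m. y r a s b)) = ?obj ybb"
      by (rule qap_blocks_of_torus_point[OF z[unfolded z_eq] m])
    obtain Y where Y: "Y \<in> SDPQAP_feasible n"
      "\<forall>r<n. \<forall>a<n. \<forall>s<n. \<forall>b<n. block n Y r a s b = y r a s b"
      by (rule qap_blocks_realize[OF y(1)])
    have "?qap Y = ?obj ybb"
    proof (subst mat_inner_energy[OF _ m(2)])
      show "Y \<in> carrier_mat (n^2) (n^2)" using Y(1) by (simp add: SDPQAP_feasible_def)
      show "(\<Sum>r<n. \<Sum>s<n. 1 / real (fst (cls r s) + snd (cls r s)) * (\<Sum>a<m. \<Sum>b<m. block n Y r a s b)) = ?obj ybb"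
        unfolding y(2)[symmetric] using m Y(2) by (intro sum.cong refl arg_cong2[where f = "(*)"]) simp
    qed
    then show ?thesis using Y(1) z_eq by auto
  qed
  obtain Y where "Y \<in> SDPQAP_feasible n"
    by (rule qap_blocks_realize[OF qap_blocks_identity]) (rule that)
  then have "?F \<noteq> {}" using down by blast
  then obtain z where z: "z \<in> ?F" "\<forall>z'\<in>?F. ?obj (fst z) \<le> ?obj (fst z')"
    by (rule torus_sdp_minimum[OF m(2)])
  have dim: "dim_row (energy_A n m) = n"
    by (simp add: energy_A_def)
  have "SDPQAP (energy_A n m) (energy_B n1 n2) = ?obj (fst z)"
    unfolding SDPQAP_def dim
  proof (rule Least_equality)
    show "\<exists>Y\<in>SDPQAP_feasible n. ?obj (fst z) = ?qap Y"
      using up[OF z(1)] by metis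
    show "?obj (fst z) \<le> v" if "\<exists>Y\<in>SDPQAP_feasible n. v = ?qap Y" for v
      using that down z(2) by fastforce
  qed
  moreover have "torus_sdp_value n1 n2 m = ereal (?obj (fst z))"
  proof -
    have "torus_sdp_value n1 n2 m = (INF y\<in>?F. ereal (?obj (fst y)))"
      by (simp add: torus_sdp_value_def case_prod_unfold)
    also have "\<dots> = ereal (?obj (fst z))"
      using z by (intro antisym INF_lower2[OF z(1)] INF_greatest) auto
    finally show ?thesis .
  qed
  ultimately show ?thesis by simp
qed

end

theorem theorem4p11:
  fixes n1 n2 n m :: nat
  assumes "n1 \<ge> 1" and "n2 \<ge> 1" and "n = n1 * n2" and "1 \<le> m" and "m \<le> n"
  shows "ereal (SDPQAP (energy_A n m) (energy_B n1 n2)) = torus_sdp_value n1 n2 m"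
  using assms torus_grid.SDPQAP_eq_torus_sdp_value[of n1 n2 m] by (simp add: torus_grid_def)

end
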